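(* With probability one there exists $n_0$ such that for every $n\ge n_0$ the function $\mathbb R^3\ni(\alpha',\theta_1',\theta_2')\mapsto Q_n(\mathbf Y_n;\alpha',\theta_1',\theta_2')$ has a unique global minimizer, denoted $(\tilde\alpha_n,\tilde\theta_{1,n},\tilde\theta_{2,n})$. Moreover, for every $(\alpha,\theta_1,\theta_2)\in(0,1)\times\mathbb N^2$, almost surely $\tilde\alpha_n\to\alpha$ and $$\begin{bmatrix}\tilde\theta_{1,n}\\ \tilde\theta_{2,n}\end{bmatrix}\to\begin{bmatrix}Y_s\\ Y_{s+1}\end{bmatrix}+\frac{1}{1+\alpha^2+\alpha^4}\begin{bmatrix}-\alpha(1+\alpha^2)Y_{s-1}-\alpha^2Y_{s+2}-(1-\alpha^3)\mu_\varepsilon\\ -\alpha^2Y_{s-1}-\alpha(1+\alpha^2)Y_{s+2}-(1-\alpha^3)\mu_\varepsilon\end{bmatrix}.$$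
   Context: INAR(1) process: Let $\alpha\in(0,1)$. Let $(\varepsilon_k)_{k\in\mathbb N}$ be i.i.d. non-negative integer-valued random variables with $\mathbb E\varepsilon_1^2<\infty$ and $\mathbb P(\varepsilon_1\ne 0)>0$; write $\mu_\varepsilon=\mathbb E\varepsilon_1$ (assumed known). For each $k\in\mathbb N$ let $(\xi_{k,j})_{j\in\mathbb N}$ be i.i.d. Bernoulli random variables with mean $\alpha$, these sequences being mutually independent and independent of $(\varepsilon_k)$. Let $X_0$ be a non-negative integer-valued random variable with $\mathbb E X_0^2<\infty$, independent of all $\xi_{k,j}$ and $\varepsilon_k$, and set $X_k=\sum_{j=1}^{X_{k-1}}\xi_{k,j}+\varepsilon_k$ for $k\in\mathbb N$. Two neighbouring additive outliers: fix a known $s\in\mathbb N$ and sizes $\theta_1,\theta_2\in\mathbb N$; $Y_k=X_k+\delta_{k,s}\theta_1+\delta_{k,s+1}\theta_2$, $k\in\mathbb Z_+$; $\mathbf Y_n=(Y_0,\dots,Y_n)$. For $n\ge s+2$, $$Q_n(\mathbf y_n;\alpha',\theta_1',\theta_2')=\sum_{\substack{k=1\\k\notin\{s,s+1,s+2\}}}^n(y_k-\alpha'y_{k-1}-\mu_\varepsilon)^2+(y_s-\alpha'y_{s-1}-\mu_\varepsilon-\theta_1')^2+(y_{s+1}-\alpha'y_s-\mu_\varepsilon+\alpha'\theta_1'-\theta_2')^2+(y_{s+2}-\alpha'y_{s+1}-\mu_\varepsilon+\alpha'\theta_2')^2 .$$ *)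

theory Defs
  imports "HOL-Probability.Probability"
begin

text \<open>Index set for the primitive random variables: the initial value X_0,
  the innovations eps_k, and the Bernoulli counting variables xi_{k,j}.\<close>
datatype inar_idx = IX0 | IEps nat | IXi nat nat

fun inarX :: "(inar_idx \<Rightarrow> 'a \<Rightarrow> nat) \<Rightarrow> nat \<Rightarrow> 'a \<Rightarrow> nat" where
  "inarX Z 0 \<omega> = Z IX0 \<omega>"
| "inarX Z (Suc k) \<omega> = (\<Sum>j = 1..inarX Z k \<omega>. Z (IXi (Suc k) j) \<omega>) + Z (IEps (Suc k)) \<omega>"

definition inarY :: "(inar_idx \<Rightarrow> 'a \<Rightarrow> nat) \<Rightarrow> nat \<Rightarrow> nat \<Rightarrow> nat \<Rightarrow> nat \<Rightarrow> 'a \<Rightarrow> nat" where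
  "inarY Z s th1 th2 k \<omega> =
     inarX Z k \<omega> + (if k = s then th1 else 0) + (if k = Suc s then th2 else 0)"

text \<open>The conditional least squares objective Q_n (meaningful for n >= s+2).\<close>
definition Qn :: "nat \<Rightarrow> real \<Rightarrow> nat \<Rightarrow> (nat \<Rightarrow> real) \<Rightarrow> real \<Rightarrow> real \<Rightarrow> real \<Rightarrow> real" where
  "Qn s mu n y a t1 t2 =
     (\<Sum>k \<in> {1..n} - {s, s+1, s+2}. (y k - a * y (k - 1) - mu)\<^sup>2)
     + (y s - a * y (s - 1) - mu - t1)\<^sup>2
     + (y (s+1) - a * y s - mu + a * t1 - t2)\<^sup>2
     + (y (s+2) - a * y (s+1) - mu + a * t2)\<^sup>2"

definition Q3 :: "nat \<Rightarrow> real \<Rightarrow> nat \<Rightarrow> (nat \<Rightarrow> real) \<Rightarrow> real \<times> real \<times> real \<Rightarrow> real" where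
  "Q3 s mu n y p = Qn s mu n y (fst p) (fst (snd p)) (snd (snd p))"

definition cls_est :: "nat \<Rightarrow> real \<Rightarrow> nat \<Rightarrow> (nat \<Rightarrow> real) \<Rightarrow> real \<times> real \<times> real" where
  "cls_est s mu n y = (THE p. \<forall>q. Q3 s mu n y p \<le> Q3 s mu n y q)"

end

theory Submission
  imports Defs
begin

text \<open>
  For fixed \<open>a\<close> the objective is a positive definite quadratic in the outlier sizes. Profiling them
  out leaves \<open>D\<^sub>n (a - E\<^sub>n / D\<^sub>n)\<^sup>2 + g(a)\<close> up to a constant, where
  \<open>D\<^sub>n = \<Sum> X\<^bsub>k-1\<^esub>\<^sup>2\<close>, \<open>E\<^sub>n = \<Sum> X\<^bsub>k-1\<^esub> (X\<^sub>k - \<mu>)\<close>, and the smooth function \<open>g \<ge> 0\<close> does not depend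
  on \<open>n\<close>. Hence everything reduces to \<open>D\<^sub>n \<rightarrow> \<infinity>\<close> and \<open>E\<^sub>n / D\<^sub>n \<rightarrow> \<alpha>\<close> almost surely.

  The first holds because infinitely many innovations are nonzero. For the second,
  \<open>E\<^sub>n - \<alpha> D\<^sub>n\<close> is a sum of the terms \<open>X\<^sub>k M\<^bsub>k+1\<^esub>\<close> with the martingale differences
  \<open>M\<^bsub>k+1\<^esub> = X\<^bsub>k+1\<^esub> - \<alpha> X\<^sub>k - \<mu>\<close>. Dividing the \<open>k\<close>-th term by \<open>V\<^bsub>k+1\<^esub> = 1 + \<Sum>\<^bsub>j\<le>k\<^esub> X\<^sub>j\<^sup>2\<close> gives
  martingale differences whose conditional variances are at most a constant times
  \<open>X\<^sub>k\<^sup>2 (1 + X\<^sub>k) / V\<^bsub>k+1\<^esub>\<^sup>2 \<le> 2 X\<^sub>k\<^sup>2 / V\<^bsub>k+1\<^esub>\<^bsup>3/2\<^esup>\<close>, which has a deterministically bounded sum. So the normalised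
  series converges almost surely, and Kronecker's lemma applies. This self-normalisation replaces
  ergodicity.
\<close>

section \<open>Deterministic asymptotics\<close>

text \<open>Summation by parts: the partial sums of \<open>x\<close> become remainders of the
  convergent series weighted by increments of \<open>b\<close>; as remainders vanish, such weighted
  sums are of smaller order than \<open>b n\<close>.\<close>

lemma kronecker_lemma:
  fixes b x :: "nat \<Rightarrow> real"
  assumes b: "incseq b" "\<And>n. b n > 0" "filterlim b at_top sequentially"
    and x: "summable (\<lambda>k. x k / b k)"
  shows "(\<lambda>n. (\<Sum>k\<le>n. x k) / b n) \<longlonglongrightarrow> 0"
proof (rule LIMSEQ_I)
  fix e :: real assume e: "e > 0"
  \<comment> \<open>Subtracting the limit makes \<open>r\<close> tend to 0, while
    \<open>r (Suc k) - r k\<close> is still \<open>x k / b k\<close>.\<close>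
  define r where "r n = (\<Sum>k<n. x k / b k) - (\<Sum>k. x k / b k)" for n
  define B where "B n = (\<Sum>k<n. r (Suc k) * (b (Suc k) - b k))" for n
  have T: "(\<Sum>k\<le>n. x k) = b n * r (Suc n) - b 0 * r 0 - B n" for n
  proof (induction n)
    case 0
    then show ?case using b(2)[of 0] by (simp add: B_def r_def algebra_simps)
  next
    case (Suc n)
    have "x (Suc n) = b (Suc n) * (r (Suc (Suc n)) - r (Suc n))"
      using b(2)[of "Suc n"] by (simp add: r_def)
    moreover have "B (Suc n) = B n + r (Suc n) * (b (Suc n) - b n)"
      by (simp add: B_def)
    ultimately show ?case using Suc by (simp add: algebra_simps)
  qed
  have "(\<lambda>n. \<Sum>k<n. x k / b k) \<longlonglongrightarrow> (\<Sum>k. x k / b k)"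
    using x by (rule summable_LIMSEQ)
  then have "r \<longlonglongrightarrow> 0"
    unfolding r_def by (simp add: LIM_zero_iff)
  then obtain N where N: "\<And>n. n \<ge> N \<Longrightarrow> \<bar>r n\<bar> \<le> e / 3"
    using e LIMSEQ_D[of r 0 "e/3"] by (force simp: less_imp_le)
  \<comment> \<open>Beyond \<open>N\<close> each increment of \<open>B\<close> is at most
    \<open>e / 3\<close> times that of \<open>b\<close>, and the latter telescope.\<close>
  have B: "\<bar>B n\<bar> \<le> \<bar>B N\<bar> + e / 3 * (b n - b N)" if "n \<ge> N" for n
    using that
  proof (induction n rule: dec_induct)
    case base
    then show ?case by simp
  next
    case (step n)
    have "\<bar>B (Suc n)\<bar> \<le> \<bar>B n\<bar> + \<bar>r (Suc n)\<bar> * (b (Suc n) - b n)"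
      using incseq_SucD[OF b(1), of n] abs_triangle_ineq[of "B n" "r (Suc n) * (b (Suc n) - b n)"]
      by (simp add: B_def abs_mult)
    also have "\<bar>r (Suc n)\<bar> * (b (Suc n) - b n) \<le> e / 3 * (b (Suc n) - b n)"
      using incseq_SucD[OF b(1), of n] N[of "Suc n"] step by (intro mult_right_mono) auto
    finally have "\<bar>B (Suc n)\<bar> \<le> \<bar>B n\<bar> + e / 3 * (b (Suc n) - b n)" by simp
    also have "\<dots> \<le> \<bar>B N\<bar> + e / 3 * (b n - b N) + e / 3 * (b (Suc n) - b n)"
      using step.IH by simp
    finally show ?case by (simp add: algebra_simps diff_divide_distrib)
  qed
  \<comment> \<open>\<open>C\<close> collects the terms that do not grow. It will be below
    \<open>e / 3 * b n\<close>, as are the other two contributions up to equality, so the total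
    stays below \<open>e * b n\<close>.\<close>
  define C where "C = \<bar>b 0 * r 0\<bar> + \<bar>B N\<bar>"
  obtain N' where N': "\<And>n. n \<ge> N' \<Longrightarrow> b n > 3 * C / e"
    using b(3) by (force simp: filterlim_at_top_dense eventually_sequentially)
  show "\<exists>no. \<forall>n\<ge>no. norm ((\<Sum>k\<le>n. x k) / b n - 0) < e"
  proof (intro exI allI impI)
    fix n assume n: "n \<ge> max N N'"
    have "\<bar>b n * r (Suc n)\<bar> \<le> b n * (e / 3)"
      using N[of "Suc n"] n b(2)[of n] by (simp add: abs_mult)
    moreover have "\<bar>B n\<bar> \<le> \<bar>B N\<bar> + e / 3 * b n"
    proof -
      have "e / 3 * (b n - b N) \<le> e / 3 * b n"
        using e b(2)[of N] by (intro mult_left_mono) auto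
      then show ?thesis using B[of n] n by simp
    qed
    moreover have "C < e / 3 * b n"
      using N'[of n] n e by (simp add: field_simps)
    ultimately have "\<bar>\<Sum>k\<le>n. x k\<bar> < e * b n"
      unfolding T C_def by (simp add: field_simps)
    then show "norm ((\<Sum>k\<le>n. x k) / b n - 0) < e"
      using b(2)[of n] by (simp add: field_simps)
  qed
qed

text \<open>A steep parabola confines every minimiser to a shrinking window around
  \<open>c n\<close>, because \<open>g\<close> is bounded below. In that window its curvature
  \<open>2 * D n\<close> eventually exceeds any negative curvature of \<open>g\<close>, which gives
  uniqueness although \<open>g\<close> need not be convex.\<close>

lemma quadratic_plus_minimizer:
  fixes g g' g'' :: "real \<Rightarrow> real" and D c :: "nat \<Rightarrow> real"
  assumes g_nonneg: "\<And>x. g x \<ge> 0"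
    and g': "\<And>x. (g has_real_derivative g' x) (at x)"
    and g'': "\<And>x. (g' has_real_derivative g'' x) (at x)"
    and g''_cont: "continuous_on UNIV g''"
    and D: "filterlim D at_top sequentially"
    and c: "c \<longlonglongrightarrow> \<alpha>"
  defines "G \<equiv> \<lambda>n a. D n * (a - c n)\<^sup>2 + g a"
  shows "\<forall>\<^sub>F n in sequentially. \<exists>!a. \<forall>b. G n a \<le> G n b"
    and "\<And>A. \<forall>\<^sub>F n in sequentially. \<forall>b. G n (A n) \<le> G n b \<Longrightarrow> A \<longlonglongrightarrow> \<alpha>"
proof -
  have g_cont: "continuous_on UNIV g"
    by (rule DERIV_continuous_on[where D = g']) (use g' in \<open>auto intro: has_field_derivative_at_within\<close>)
  have gc: "(\<lambda>n. g (c n)) \<longlonglongrightarrow> g \<alpha>"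
    using g_cont c by (auto simp: continuous_on_eq_continuous_at isCont_tendsto_compose)
  have ratio: "(\<lambda>n. sqrt (g (c n) / D n)) \<longlonglongrightarrow> 0"
    using tendsto_real_sqrt[OF real_tendsto_divide_at_top[OF gc D]] by simp
  have Dpos: "\<forall>\<^sub>F n in sequentially. D n > K" for K
    using D by (simp add: filterlim_at_top_dense)
  have bound: "\<bar>a - c n\<bar> \<le> sqrt (g (c n) / D n)" if "D n > 0" "G n a \<le> G n (c n)" for n a
  proof -
    have "D n * (a - c n)\<^sup>2 \<le> g (c n)"
      using that(2) g_nonneg[of a] by (simp add: G_def)
    then have "(a - c n)\<^sup>2 \<le> g (c n) / D n"
      using that(1) by (simp add: field_simps)
    then show ?thesis
      by (metis real_sqrt_abs real_sqrt_le_iff)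
  qed
  show "A \<longlonglongrightarrow> \<alpha>" if A: "\<forall>\<^sub>F n in sequentially. \<forall>b. G n (A n) \<le> G n b" for A
  proof -
    have "(\<lambda>n. A n - c n) \<longlonglongrightarrow> 0"
    proof (rule Lim_null_comparison[OF _ ratio])
      show "\<forall>\<^sub>F n in sequentially. norm (A n - c n) \<le> sqrt (g (c n) / D n)"
        using A Dpos[of 0] by eventually_elim (auto intro: bound)
    qed
    from tendsto_add[OF this c] show ?thesis by simp
  qed
  \<comment> \<open>Minimisers will lie within 1 of \<open>c n\<close>, and \<open>c n\<close>
    within 1 of the limit, hence the radius 2.\<close>
  obtain K where K: "\<And>x. x \<in> {\<alpha> - 2..\<alpha> + 2} \<Longrightarrow> \<bar>g'' x\<bar> \<le> K"
  proof -
    have "compact (g'' ` {\<alpha> - 2..\<alpha> + 2})"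
      by (intro compact_continuous_image continuous_on_subset[OF g''_cont]) auto
    then show ?thesis
      using that by (force dest!: compact_imp_bounded simp: bounded_iff)
  qed
  have lip: "\<bar>g' a - g' b\<bar> \<le> K * \<bar>a - b\<bar>" if "a \<in> {\<alpha> - 2..\<alpha> + 2}" "b \<in> {\<alpha> - 2..\<alpha> + 2}" for a b
    using field_differentiable_bound[of "{\<alpha> - 2..\<alpha> + 2}" g' g'' K a b] that K
      has_field_derivative_at_within[OF g'']
    by auto
  have ev1: "\<forall>\<^sub>F n in sequentially. dist (c n) \<alpha> < 1"
    using tendstoD[OF c zero_less_one] .
  have ev2: "\<forall>\<^sub>F n in sequentially. dist (sqrt (g (c n) / D n)) 0 < 1"
    using tendstoD[OF ratio zero_less_one] by simp
  show "\<forall>\<^sub>F n in sequentially. \<exists>!a. \<forall>b. G n a \<le> G n b"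
    using ev1 ev2 Dpos[of 0] Dpos[of "K / 2"]
  proof eventually_elim
    case (elim n)
    have G_cont: "continuous_on S (G n)" for S
      unfolding G_def by (intro continuous_intros continuous_on_subset[OF g_cont]) auto
    have loc: "\<bar>a - c n\<bar> \<le> 1" if "G n a \<le> G n (c n)" for a
      using bound[of n a] that elim by (auto simp: dist_real_def)
    obtain a where a: "a \<in> {c n - 1..c n + 1}" "\<And>b. b \<in> {c n - 1..c n + 1} \<Longrightarrow> G n a \<le> G n b"
      using continuous_attains_inf[OF _ _ G_cont, of "{c n - 1..c n + 1}"] by auto
    \<comment> \<open>The minimum over the compact window is global: a point outside it has a larger
      value than \<open>c n\<close>, which is in the window.\<close>
    have a_min: "G n a \<le> G n b" for b
    proof (cases "G n b \<le> G n (c n)")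
      case True
      then show ?thesis using loc[of b] a(2)[of b] by (auto simp: abs_le_iff)
    next
      case False
      then show ?thesis using a(2)[of "c n"] by auto
    qed
    have crit: "2 * D n * (b - c n) + g' b = 0" if "\<And>x. G n b \<le> G n x" for b
    proof (rule DERIV_local_min[where d = 1 and f = "G n" and x = b])
      show "(G n has_real_derivative 2 * D n * (b - c n) + g' b) (at b)"
        unfolding G_def by (auto intro!: derivative_eq_intros g')
    qed (use that in auto)
    show ?case
    proof (rule ex1I[of _ a])
      fix b assume b: "\<forall>x. G n b \<le> G n x"
      have "\<bar>a - c n\<bar> \<le> 1" "\<bar>b - c n\<bar> \<le> 1" using loc a_min b by auto
      then have "a \<in> {\<alpha> - 2..\<alpha> + 2}" "b \<in> {\<alpha> - 2..\<alpha> + 2}"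
        using elim(1) by (auto simp: dist_real_def)
      note lip[OF this]
      \<comment> \<open>Subtracting the two critical point equations gives
        \<open>2 * D n * \<bar>a - b\<bar> \<le> K * \<bar>a - b\<bar>\<close>, which forces
        equality once \<open>2 * D n > K\<close>.\<close>
      moreover have "g' a - g' b = - (2 * D n * (a - b))"
        using crit[OF a_min] crit[of b] b by (simp add: algebra_simps)
      then have "\<bar>g' a - g' b\<bar> = 2 * D n * \<bar>a - b\<bar>"
        using elim(3) by (simp add: abs_mult)
      ultimately have "(2 * D n - K) * \<bar>a - b\<bar> \<le> 0"
        by (simp add: left_diff_distrib)
      then show "b = a"
        using elim(4) by (simp add: mult_le_0_iff)
    qed (use a_min in auto)
  qed
qed

text \<open>Purely pathwise: once the sizes are profiled out, the estimator of
  \<open>\<alpha>\<close> minimises a steep parabola plus a fixed function, and the size estimators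
  are continuous functions of it.\<close>

lemma cls_asymptotics:
  fixes y :: "nat \<Rightarrow> real" and mu \<alpha> :: real and s :: nat
  defines "D \<equiv> \<lambda>n. \<Sum>k\<in>{1..n} - {s, s+1, s+2}. (y (k - 1))\<^sup>2"
    and "E \<equiv> \<lambda>n. \<Sum>k\<in>{1..n} - {s, s+1, s+2}. y (k - 1) * (y k - mu)"
  assumes D: "filterlim D at_top sequentially"
    and ED: "(\<lambda>n. E n / D n) \<longlonglongrightarrow> \<alpha>"
  shows "\<forall>\<^sub>F n in sequentially. \<exists>!p. \<forall>q. Q3 s mu n y p \<le> Q3 s mu n y q"
    and "(\<lambda>n. fst (cls_est s mu n y)) \<longlonglongrightarrow> \<alpha>"
    and "(\<lambda>n. fst (snd (cls_est s mu n y))) \<longlonglongrightarrow>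
      y s + (- \<alpha> * (1 + \<alpha>\<^sup>2) * y (s - 1) - \<alpha>\<^sup>2 * y (s + 2) - (1 - \<alpha> ^ 3) * mu) / (1 + \<alpha>\<^sup>2 + \<alpha> ^ 4)"
    and "(\<lambda>n. snd (snd (cls_est s mu n y))) \<longlonglongrightarrow>
      y (s + 1) + (- \<alpha>\<^sup>2 * y (s - 1) - \<alpha> * (1 + \<alpha>\<^sup>2) * y (s + 2) - (1 - \<alpha> ^ 3) * mu) / (1 + \<alpha>\<^sup>2 + \<alpha> ^ 4)"
proof -
  \<comment> \<open>With \<open>r1\<close>, \<open>r2\<close>, \<open>r3\<close> the three special
    residuals, \<open>h a\<close> is \<open>a\<^sup>2 * r1 + a * r2 + r3\<close>, in which both
    sizes cancel, and \<open>p a\<close> is the squared norm of the coefficient vector. So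
    \<open>g\<close> below is the least value of the three squares over the sizes.\<close>
  define p p' p'' :: "real \<Rightarrow> real"
    where "p = (\<lambda>a. 1 + a\<^sup>2 + a ^ 4)" and "p' = (\<lambda>a. 2 * a + 4 * a ^ 3)"
      and "p'' = (\<lambda>a. 2 + 12 * a\<^sup>2)"
  define h h' h'' :: "real \<Rightarrow> real"
    where "h = (\<lambda>a. y (s+2) - a ^ 3 * y (s-1) - (1 + a + a\<^sup>2) * mu)"
      and "h' = (\<lambda>a. - 3 * a\<^sup>2 * y (s-1) - (1 + 2 * a) * mu)"
      and "h'' = (\<lambda>a. - 6 * a * y (s-1) - 2 * mu)"
  define g where "g a = (h a)\<^sup>2 / p a" for a
  \<comment> \<open>Writing \<open>g\<close> as \<open>v\<^sup>2 * p\<close> with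
    \<open>v = h / p\<close> keeps the derivatives short, since
    \<open>v' * p = h' - v * p'\<close>.\<close>
  define v v' where "v a = h a / p a" and "v' a = (h' a - v a * p' a) / p a" for a
  define g' where "g' a = 2 * v a * h' a - (v a)\<^sup>2 * p' a" for a
  define g'' where "g'' a = 2 * (v' a * h' a + v a * h'' a) - (2 * v a * v' a * p' a + (v a)\<^sup>2 * p'' a)" for a
  define T1 where "T1 a = y s + (- a * (1 + a\<^sup>2) * y (s - 1) - a\<^sup>2 * y (s + 2) - (1 - a ^ 3) * mu) / p a" for a
  define T2 where "T2 a = y (s + 1) + (- a\<^sup>2 * y (s - 1) - a * (1 + a\<^sup>2) * y (s + 2) - (1 - a ^ 3) * mu) / p a" for a
  have p_pos: "p a > 0" for a
    unfolding p_def using zero_le_even_power[of 4 a] by (simp add: add_pos_nonneg)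
  then have p_nz: "p a \<noteq> 0" for a by (simp add: less_imp_neq[symmetric])
  have deriv: "(p has_real_derivative p' a) (at a)" "(p' has_real_derivative p'' a) (at a)"
     "(h has_real_derivative h' a) (at a)" "(h' has_real_derivative h'' a) (at a)" for a
    unfolding p_def p'_def p''_def h_def h'_def h''_def
    by (auto intro!: derivative_eq_intros simp: algebra_simps power2_eq_square power3_eq_cube)
  have v': "(v has_real_derivative v' a) (at a)" for a
    unfolding v_def v'_def using p_nz[of a]
    by (auto intro!: derivative_eq_intros deriv simp: field_simps)
  have g': "(g has_real_derivative g' a) (at a)" for a
  proof -
    have "((\<lambda>a. (v a)\<^sup>2 * p a) has_real_derivative 2 * v a * (v' a * p a) + (v a)\<^sup>2 * p' a) (at a)"
      by (auto intro!: derivative_eq_intros deriv v')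
    also have "2 * v a * (v' a * p a) + (v a)\<^sup>2 * p' a = g' a"
    proof -
      have "v' a * p a = h' a - v a * p' a" using p_nz[of a] by (simp add: v'_def)
      then show ?thesis unfolding g'_def by algebra
    qed
    also have "(\<lambda>a. (v a)\<^sup>2 * p a) = g"
      using p_nz by (auto simp: g_def v_def power_divide power2_eq_square)
    finally show ?thesis .
  qed
  have g'': "(g' has_real_derivative g'' a) (at a)" for a
    unfolding g'_def g''_def
    by (auto intro!: derivative_eq_intros deriv v' simp: algebra_simps)
  have cont: "continuous_on UNIV p" "continuous_on UNIV p'" "continuous_on UNIV p''"
     "continuous_on UNIV h" "continuous_on UNIV h'" "continuous_on UNIV h''"
    unfolding p_def p'_def p''_def h_def h'_def h''_def by (intro continuous_intros)+
  have g''_cont: "continuous_on UNIV g''"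
    unfolding g''_def v'_def v_def using p_nz by (intro continuous_intros cont) auto
  have T_cont: "isCont T1 a" "isCont T2 a" for a
    unfolding T1_def T2_def p_def using p_nz[of a, unfolded p_def] by (intro continuous_intros; simp)+
  define c where "c n = E n / D n" for n
  define G where "G n a = D n * (a - c n)\<^sup>2 + g a" for n a
  define C where "C n = (\<Sum>k\<in>{1..n} - {s, s+1, s+2}. (y k - mu)\<^sup>2) - D n * (c n)\<^sup>2" for n
  \<comment> \<open>\<open>R a u v\<close> is the squared length of the change in the three
    residuals when the sizes move by \<open>u\<close> and \<open>v\<close>.\<close>
  define R :: "real \<Rightarrow> real \<Rightarrow> real \<Rightarrow> real"
    where "R a u v = u\<^sup>2 + (a * u - v)\<^sup>2 + (a * v)\<^sup>2" for a u v
  have R0: "R a u v = 0 \<longleftrightarrow> u = 0 \<and> v = 0" and R_nonneg: "R a u v \<ge> 0" for a u v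
    unfolding R_def by (auto simp: add_nonneg_eq_0_iff)
  \<comment> \<open>\<open>T1 a\<close>, \<open>T2 a\<close> are the optimal outlier sizes for given \<open>a\<close>; the three residuals there are
    proportional to \<open>a\<^sup>2\<close>, \<open>a\<close>, 1.\<close>
  have Q: "Q3 s mu n y (a, t1, t2) = G n a + C n + R a (t1 - T1 a) (t2 - T2 a)"
    if D0: "D n > 0" for n a t1 t2
  proof -
    define w u z where "w = h a / p a" and "u = t1 - T1 a" and "z = t2 - T2 a"
    have "(\<Sum>k\<in>{1..n} - {s, s+1, s+2}. (y k - a * y (k - 1) - mu)\<^sup>2)
        = (\<Sum>k\<in>{1..n} - {s, s+1, s+2}. (y k - mu)\<^sup>2 - 2 * a * (y (k - 1) * (y k - mu)) + a\<^sup>2 * (y (k - 1))\<^sup>2)"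
      by (intro sum.cong) (auto simp: power2_eq_square algebra_simps)
    also have "\<dots> = (\<Sum>k\<in>{1..n} - {s, s+1, s+2}. (y k - mu)\<^sup>2) - 2 * a * E n + a\<^sup>2 * D n"
      by (simp add: sum.distrib sum_subtractf sum_distrib_left D_def E_def)
    also have "\<dots> = D n * (a - c n)\<^sup>2 + C n"
      using D0 by (simp add: C_def c_def field_simps power2_eq_square)
    finally have 0: "(\<Sum>k\<in>{1..n} - {s, s+1, s+2}. (y k - a * y (k - 1) - mu)\<^sup>2) = D n * (a - c n)\<^sup>2 + C n" .
    have wp: "w * p a = h a" using p_nz[of a] by (simp add: w_def)
    have T: "(T1 a - y s) * p a = - a * (1 + a\<^sup>2) * y (s - 1) - a\<^sup>2 * y (s + 2) - (1 - a ^ 3) * mu"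
      "(T2 a - y (s+1)) * p a = - a\<^sup>2 * y (s - 1) - a * (1 + a\<^sup>2) * y (s + 2) - (1 - a ^ 3) * mu"
      using p_nz[of a] by (simp_all add: T1_def T2_def)
    \<comment> \<open>The unknown differences become atoms; after multiplication by
      \<open>p a\<close> the residual formulas are polynomial consequences of \<open>T\<close> and
      \<open>wp\<close>.\<close>
    define e1 e2 where e_def: "e1 = T1 a - y s" "e2 = T2 a - y (s + 1)"
    have eqI: "l = r" if "l * p a = r * p a" for l r using that p_nz[of a] by simp
    have "- (a * y (s - 1) + mu) - (T1 a - y s) = a\<^sup>2 * w"
      by (rule eqI) (use T wp in \<open>unfold e_def[symmetric] p_def h_def, algebra\<close>)
    then have 1: "y s - a * y (s - 1) - mu - t1 = a\<^sup>2 * w - u"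
      by (simp add: u_def)
    have "a * (T1 a - y s) - mu - (T2 a - y (s+1)) = a * w"
      by (rule eqI) (use T wp in \<open>unfold e_def[symmetric] p_def h_def, algebra\<close>)
    then have 2: "y (s+1) - a * y s - mu + a * t1 - t2 = a * w + a * u - z"
      by (simp add: u_def z_def algebra_simps)
    have "y (s+2) - mu + a * (T2 a - y (s+1)) = w"
      by (rule eqI) (use T wp in \<open>unfold e_def[symmetric] p_def h_def, algebra\<close>)
    then have 3: "y (s+2) - a * y (s+1) - mu + a * t2 = w + a * z"
      by (simp add: z_def algebra_simps)
    have "g a = w\<^sup>2 * p a"
      unfolding g_def w_def using p_nz[of a] by (simp add: field_simps power2_eq_square)
    \<comment> \<open>Pythagoras: the optimal residual vector \<open>w * (a\<^sup>2, a, 1)\<close>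
      is orthogonal to the change \<open>(-u, a * u - z, a * z)\<close>, so no cross term
      survives.\<close>
    then have 4: "(a\<^sup>2 * w - u)\<^sup>2 + (a * w + a * u - z)\<^sup>2 + (w + a * z)\<^sup>2 = g a + R a u z"
      unfolding R_def p_def by (simp add: algebra_simps power2_eq_square power4_eq_xxxx)
    show ?thesis
      unfolding Q3_def Qn_def fst_conv snd_conv 0 1 2 3 using 4 by (simp add: G_def u_def z_def)
  qed
  have minQ: "(\<forall>q. Q3 s mu n y (a, t1, t2) \<le> Q3 s mu n y q) \<longleftrightarrow>
      (\<forall>b. G n a \<le> G n b) \<and> t1 = T1 a \<and> t2 = T2 a" if D0: "D n > 0" for n a t1 t2
  proof (intro iffI conjI allI)
    assume L: "\<forall>q. Q3 s mu n y (a, t1, t2) \<le> Q3 s mu n y q"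
    show "G n a \<le> G n b" for b
      using L[rule_format, of "(b, T1 b, T2 b)"] R_nonneg[of a "t1 - T1 a" "t2 - T2 a"] R0[of b 0 0]
      by (simp add: Q[OF D0])
    have "R a (t1 - T1 a) (t2 - T2 a) \<le> 0"
      using L[rule_format, of "(a, T1 a, T2 a)"] R0[of a 0 0] by (simp add: Q[OF D0])
    then have "R a (t1 - T1 a) (t2 - T2 a) = 0"
      using R_nonneg[of a] by (simp add: order_antisym)
    then show "t1 = T1 a" "t2 = T2 a" by (auto simp: R0)
  next
    fix q :: "real \<times> real \<times> real"
    assume L: "(\<forall>b. G n a \<le> G n b) \<and> t1 = T1 a \<and> t2 = T2 a"
    obtain b u v where q: "q = (b, u, v)" by (cases q)
    have "G n a \<le> G n b" using L by blast
    then have "G n a \<le> G n b + R b (u - T1 b) (v - T2 b)"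
      using R_nonneg[of b "u - T1 b" "v - T2 b"] by simp
    then show "Q3 s mu n y (a, t1, t2) \<le> Q3 s mu n y q"
      using L R0[of a 0 0] by (simp add: Q[OF D0] q)
  qed
  have g_nonneg: "g a \<ge> 0" for a
    unfolding g_def using p_pos[of a] by simp
  note min = quadratic_plus_minimizer[of g g' g'' D c \<alpha>, OF g_nonneg g' g'' g''_cont D ED[folded c_def],
      folded G_def]
  have Dpos: "\<forall>\<^sub>F n in sequentially. D n > 0"
    using D by (simp add: filterlim_at_top_dense)
  \<comment> \<open>For small \<open>n\<close> this may be an arbitrary value; only its eventual
    behaviour enters the limits.\<close>
  define A where "A n = (THE a. \<forall>b. G n a \<le> G n b)" for n
  have ev: "\<forall>\<^sub>F n in sequentially. (\<forall>b. G n (A n) \<le> G n b) \<and> (\<exists>!p. \<forall>q. Q3 s mu n y p \<le> Q3 s mu n y q)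
      \<and> cls_est s mu n y = (A n, T1 (A n), T2 (A n))"
    using Dpos min(1)
  proof eventually_elim
    case (elim n)
    have A: "\<forall>b. G n (A n) \<le> G n b"
      unfolding A_def by (rule theI'[OF elim(2)])
    have 1: "\<forall>q. Q3 s mu n y (A n, T1 (A n), T2 (A n)) \<le> Q3 s mu n y q"
      using A minQ[OF elim(1)] by blast
    have 2: "p = (A n, T1 (A n), T2 (A n))" if p: "\<forall>q. Q3 s mu n y p \<le> Q3 s mu n y q" for p
    proof -
      obtain a u v where q: "p = (a, u, v)" by (cases p)
      then have "\<forall>b. G n a \<le> G n b" "u = T1 a" "v = T2 a"
        using minQ[OF elim(1), of a u v] p by auto
      moreover from this A elim(2) have "a = A n" by blast
      ultimately show ?thesis using q by simp
    qed
    have "cls_est s mu n y = (A n, T1 (A n), T2 (A n))"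
      unfolding cls_est_def by (rule the_equality) (fact 1, fact 2)
    then show ?case using A 1 2 by blast
  qed
  show "\<forall>\<^sub>F n in sequentially. \<exists>!p. \<forall>q. Q3 s mu n y p \<le> Q3 s mu n y q"
    using ev by eventually_elim blast
  have A: "A \<longlonglongrightarrow> \<alpha>"
    by (rule min(2)) (use ev in eventually_elim, blast)
  then have T: "(\<lambda>n. T1 (A n)) \<longlonglongrightarrow> T1 \<alpha>" "(\<lambda>n. T2 (A n)) \<longlonglongrightarrow> T2 \<alpha>"
    using T_cont by (auto intro: isCont_tendsto_compose)
  show "(\<lambda>n. fst (cls_est s mu n y)) \<longlonglongrightarrow> \<alpha>"
    by (rule Lim_transform_eventually[OF A]) (use ev in eventually_elim, simp)
  have "(\<lambda>n. fst (snd (cls_est s mu n y))) \<longlonglongrightarrow> T1 \<alpha>"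
    by (rule Lim_transform_eventually[OF T(1)]) (use ev in eventually_elim, simp)
  then show "(\<lambda>n. fst (snd (cls_est s mu n y))) \<longlonglongrightarrow>
      y s + (- \<alpha> * (1 + \<alpha>\<^sup>2) * y (s - 1) - \<alpha>\<^sup>2 * y (s + 2) - (1 - \<alpha> ^ 3) * mu) / (1 + \<alpha>\<^sup>2 + \<alpha> ^ 4)"
    unfolding T1_def p_def .
  have "(\<lambda>n. snd (snd (cls_est s mu n y))) \<longlonglongrightarrow> T2 \<alpha>"
    by (rule Lim_transform_eventually[OF T(2)]) (use ev in eventually_elim, simp)
  then show "(\<lambda>n. snd (snd (cls_est s mu n y))) \<longlonglongrightarrow>
      y (s + 1) + (- \<alpha>\<^sup>2 * y (s - 1) - \<alpha> * (1 + \<alpha>\<^sup>2) * y (s + 2) - (1 - \<alpha> ^ 3) * mu) / (1 + \<alpha>\<^sup>2 + \<alpha> ^ 4)"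
    unfolding T2_def p_def .
qed

section \<open>Square-integrable martingale differences\<close>

lemma abs_mult_le_sum_squares: "\<bar>a * b\<bar> \<le> a\<^sup>2 + b\<^sup>2" for a b :: real
proof -
  have "2 * \<bar>a * b\<bar> \<le> a\<^sup>2 + b\<^sup>2"
    using sum_squares_bound[of "\<bar>a\<bar>" "\<bar>b\<bar>"] by (simp add: abs_mult mult.assoc)
  then show ?thesis using abs_ge_zero[of "a * b"] by linarith
qed

text \<open>\<open>d k\<close> is revealed at time \<open>k + 1\<close> and has zero conditional
  expectation given \<open>F k\<close>, expressed through integrals over events of
  \<open>F k\<close>.\<close>

locale martingale_differences = prob_space M for M :: "'a measure" +
  fixes F :: "nat \<Rightarrow> 'a measure" and d :: "nat \<Rightarrow> 'a \<Rightarrow> real"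
  assumes F_subalg: "\<And>k. subalgebra M (F k)"
    and F_mono: "\<And>k. sets (F k) \<subseteq> sets (F (Suc k))"
    and d_adapted: "\<And>k. d k \<in> borel_measurable (F (Suc k))"
    and d_sq: "\<And>k. integrable M (\<lambda>x. (d k x)\<^sup>2)"
    and d_centred: "\<And>k A. A \<in> sets (F k) \<Longrightarrow> (\<integral>x\<in>A. d k x \<partial>M) = 0"
begin

lemma F_measurable_mono: "i \<le> j \<Longrightarrow> f \<in> borel_measurable (F i) \<Longrightarrow> f \<in> borel_measurable (F j)"
proof (induction j rule: dec_induct)
  case (step j)
  have "space (F j) = space (F (Suc j))"
    using F_subalg by (simp add: subalgebra_def)
  then have "subalgebra (F (Suc j)) (F j)"
    using F_mono by (simp add: subalgebra_def)
  then show ?case using step by (auto intro: measurable_from_subalg)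
qed simp

lemma F_measurable: "f \<in> borel_measurable (F i) \<Longrightarrow> f \<in> borel_measurable M"
  using F_subalg measurable_from_subalg by blast

lemma d_measurable [measurable]: "d k \<in> borel_measurable M"
  using d_adapted F_measurable by blast

lemma d_adapted_le: "i < j \<Longrightarrow> d i \<in> borel_measurable (F j)"
  using F_measurable_mono[OF _ d_adapted, of i j] by simp

text \<open>A factor known at time \<open>k\<close> can be pulled out of the conditional expectation
  given \<open>F k\<close>, and that of \<open>d k\<close> is zero.\<close>

lemma d_orthogonal:
  assumes W: "W \<in> borel_measurable (F k)" and int: "integrable M (\<lambda>x. W x * d k x)"
  shows "(\<integral>x. W x * d k x \<partial>M) = 0"
proof -
  interpret S: finite_measure_subalgebra M "F k"
    by standard (rule F_subalg)
  have "integrable M (d k)"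
    using square_integrable_imp_integrable[OF _ d_sq] by simp
  then have 0: "AE x in M. real_cond_exp M (F k) (d k) x = (\<lambda>_. 0) x"
    by (intro S.real_cond_exp_charact) (auto simp: d_centred)
  have "(\<integral>x. W x * d k x \<partial>M) = (\<integral>x. W x * real_cond_exp M (F k) (d k) x \<partial>M)"
    using S.real_cond_exp_intg(2)[OF int W] by simp
  also have "\<dots> = (\<integral>x. 0 \<partial>M)"
    using 0 F_measurable[OF W] by (intro integral_cong_AE) auto
  finally show ?thesis by simp
qed

text \<open>Stopping at the first passage of the level is a transform of this kind, with \<open>c\<close> an indicator.\<close>
lemma transform_second_moment:
  assumes c: "\<And>k. c k \<in> borel_measurable (F k)" "\<And>k x. \<bar>c k x\<bar> \<le> 1"
  shows "integrable M (\<lambda>x. (\<Sum>k = m..<n. c k x * d k x)\<^sup>2)"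
    and "(\<integral>x. (\<Sum>k = m..<n. c k x * d k x)\<^sup>2 \<partial>M) \<le> (\<Sum>k = m..<n. \<integral>x. (d k x)\<^sup>2 \<partial>M)"
proof -
  have [measurable]: "c k \<in> borel_measurable M" for k
    using c(1) F_measurable by blast
  define S where "S n x = (\<Sum>k = m..<n. c k x * d k x)" for n x
  have SF: "S n \<in> borel_measurable (F n)" for n
    unfolding S_def by (intro borel_measurable_sum borel_measurable_times F_measurable_mono[OF _ c(1)] d_adapted_le) auto
  note [measurable] = F_measurable[OF SF]
  have csq: "(c k x)\<^sup>2 * (d k x)\<^sup>2 \<le> (d k x)\<^sup>2" for k x
    using c(2)[of k x] by (simp add: mult_left_le_one_le abs_square_le_1)
  have cd: "integrable M (\<lambda>x. (c k x * d k x)\<^sup>2)" for k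
    by (rule Bochner_Integration.integrable_bound[OF d_sq[of k]])
       (auto simp: power_mult_distrib csq)
  have "integrable M (\<lambda>x. (S n x)\<^sup>2) \<and> (\<integral>x. (S n x)\<^sup>2 \<partial>M) \<le> (\<Sum>k = m..<n. \<integral>x. (d k x)\<^sup>2 \<partial>M)"
  proof (induction n)
    case 0
    then show ?case by (simp add: S_def)
  next
    case (Suc n)
    show ?case
    proof (cases "m \<le> n")
      case True
      have eq: "(S (Suc n) x)\<^sup>2 = (S n x)\<^sup>2 + 2 * (S n x * c n x * d n x) + (c n x * d n x)\<^sup>2" for x
        using True by (simp add: S_def power2_sum)
      have i: "integrable M (\<lambda>x. S n x * c n x * d n x)"
      proof (rule Bochner_Integration.integrable_bound)
        show "integrable M (\<lambda>x. (S n x)\<^sup>2 + (c n x * d n x)\<^sup>2)"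
          using Suc cd by auto
        have "\<bar>S n x * c n x * d n x\<bar> \<le> (S n x)\<^sup>2 + (c n x * d n x)\<^sup>2" for x
          using abs_mult_le_sum_squares[of "S n x" "c n x * d n x"] by (simp add: mult.assoc)
        then show "AE x in M. norm (S n x * c n x * d n x) \<le> norm ((S n x)\<^sup>2 + (c n x * d n x)\<^sup>2)"
          by auto
      qed simp
      \<comment> \<open>\<open>S n\<close> and \<open>c n\<close> are both known at time
        \<open>n\<close>, so the cross term vanishes and second moments add.\<close>
      have 0: "(\<integral>x. S n x * c n x * d n x \<partial>M) = 0"
        by (rule d_orthogonal[OF _ i]) (intro borel_measurable_times SF c(1))
      have "(\<integral>x. (c n x * d n x)\<^sup>2 \<partial>M) \<le> (\<integral>x. (d n x)\<^sup>2 \<partial>M)"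
        using cd d_sq csq by (intro integral_mono) (auto simp: power_mult_distrib)
      then show ?thesis
        unfolding eq using Suc i 0 cd True by simp
    next
      case False
      then show ?thesis by (simp add: S_def)
    qed
  qed
  then show "integrable M (\<lambda>x. (\<Sum>k = m..<n. c k x * d k x)\<^sup>2)"
    and "(\<integral>x. (\<Sum>k = m..<n. c k x * d k x)\<^sup>2 \<partial>M) \<le> (\<Sum>k = m..<n. \<integral>x. (d k x)\<^sup>2 \<partial>M)"
    by (simp_all add: S_def)
qed

text \<open>Kolmogorov's argument: the sum stopped when it first reaches the level stays at or above
  the level in absolute value, and Markov's inequality for its square applies.\<close>

lemma maximal_inequality:
  assumes l: "l > 0"
  shows "prob {x \<in> space M. \<exists>j\<in>{m..n}. \<bar>\<Sum>k = m..<j. d k x\<bar> \<ge> l}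
           \<le> (\<Sum>k = m..<n. \<integral>x. (d k x)\<^sup>2 \<partial>M) / l\<^sup>2"
proof -
  define S where "S j x = (\<Sum>k = m..<j. d k x)" for j x
  \<comment> \<open>The \<open>k\<close>-th increment is kept while the level has not been reached
    up to \<open>S k\<close>. Since \<open>S k\<close> uses only increments before \<open>k\<close>,
    the coefficient is known at time \<open>k\<close>.\<close>
  define c :: "nat \<Rightarrow> 'a \<Rightarrow> real" where "c k x = of_bool (\<forall>j\<in>{m..k}. \<bar>S j x\<bar> < l)" for k x
  have c: "c k \<in> borel_measurable (F k)" for k
  proof -
    have [measurable]: "S j \<in> borel_measurable (F k)" if "j \<in> {m..k}" for j
      unfolding S_def using that by (intro borel_measurable_sum d_adapted_le) auto
    show ?thesis unfolding c_def by measurable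
  qed
  note mom = transform_second_moment[of c m n, OF c]
  define T where "T x = (\<Sum>k = m..<n. c k x * d k x)" for x
  have [measurable]: "T \<in> borel_measurable M"
    unfolding T_def using c F_measurable by (intro borel_measurable_sum borel_measurable_times) auto
  \<comment> \<open>With \<open>i\<close> the first passage, all coefficients before
    \<open>i\<close> are 1 and those from \<open>i\<close> on are 0, so \<open>T\<close> freezes at
    \<open>S i\<close>.\<close>
  have stop: "\<bar>T x\<bar> \<ge> l" if "j \<in> {m..n}" "\<bar>S j x\<bar> \<ge> l" for j x
  proof -
    define i where "i = (LEAST j. j \<in> {m..n} \<and> \<bar>S j x\<bar> \<ge> l)"
    have i: "i \<in> {m..n}" "\<bar>S i x\<bar> \<ge> l"
      using LeastI[of "\<lambda>j. j \<in> {m..n} \<and> \<bar>S j x\<bar> \<ge> l" j] that unfolding i_def by auto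
    have min: "\<bar>S k x\<bar> < l" if "k \<in> {m..<i}" for k
      using not_less_Least[of k "\<lambda>j. j \<in> {m..n} \<and> \<bar>S j x\<bar> \<ge> l"] that i unfolding i_def by auto
    have "T x = (\<Sum>k = m..<i. c k x * d k x) + (\<Sum>k = i..<n. c k x * d k x)"
      unfolding T_def using i(1) by (simp add: sum.atLeastLessThan_concat)
    also have "(\<Sum>k = i..<n. c k x * d k x) = 0"
    proof (rule sum.neutral, rule ballI)
      fix k assume "k \<in> {i..<n}"
      then have "c k x = 0"
        using i unfolding c_def by (auto simp: not_less)
      then show "c k x * d k x = 0" by simp
    qed
    also have "(\<Sum>k = m..<i. c k x * d k x) = S i x"
      unfolding S_def using min by (intro sum.cong) (auto simp: c_def)
    finally show ?thesis using i by simp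
  qed
  have "prob {x \<in> space M. \<exists>j\<in>{m..n}. \<bar>S j x\<bar> \<ge> l} \<le> prob {x \<in> space M. (T x)\<^sup>2 \<ge> l\<^sup>2}"
    using stop l by (intro finite_measure_mono) (auto intro!: abs_le_square_iff[THEN iffD1] simp: abs_of_pos)
  also have "\<dots> \<le> (\<integral>x. (T x)\<^sup>2 \<partial>M) / l\<^sup>2"
    using mom(1) l by (intro integral_Markov_inequality_measure[where A = "{}"]) (auto simp: T_def c_def)
  also have "\<dots> \<le> (\<Sum>k = m..<n. \<integral>x. (d k x)\<^sup>2 \<partial>M) / l\<^sup>2"
    using mom(2) by (intro divide_right_mono) (auto simp: T_def c_def)
  finally show ?thesis by (simp add: S_def)
qed

text \<open>The chance that partial sums started at \<open>m\<close> ever reach a level is bounded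
  by a variance tail, which vanishes as \<open>m\<close> grows; so almost surely the partial sums
  are Cauchy.\<close>

theorem AE_summable:
  assumes sum: "summable (\<lambda>k. \<integral>x. (d k x)\<^sup>2 \<partial>M)"
  shows "AE x in M. summable (\<lambda>k. d k x)"
proof -
  define v where "v k = (\<integral>x. (d k x)\<^sup>2 \<partial>M)" for k
  have v_nonneg: "v k \<ge> 0" for k
    by (simp add: v_def)
  have v: "summable v" using sum unfolding v_def .
  have tail: "prob {x \<in> space M. \<exists>j\<in>{m..}. \<bar>\<Sum>k = m..<j. d k x\<bar> \<ge> l} \<le> (\<Sum>k. v (k + m)) / l\<^sup>2"
    if l: "l > 0" for m and l :: real
  proof (rule LIMSEQ_le_const2)
    define A where "A n = {x \<in> space M. \<exists>j\<in>{m..n}. \<bar>\<Sum>k = m..<j. d k x\<bar> \<ge> l}" for n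
    \<comment> \<open>Continuity from below passes from a finite horizon to an infinite one.\<close>
    have "(\<lambda>n. prob (A n)) \<longlonglongrightarrow> prob (\<Union>n. A n)"
    proof (rule finite_Lim_measure_incseq)
      show "range A \<subseteq> events" unfolding A_def by auto
      show "incseq A" unfolding A_def incseq_def by fastforce
    qed
    also have "(\<Union>n. A n) = {x \<in> space M. \<exists>j\<in>{m..}. \<bar>\<Sum>k = m..<j. d k x\<bar> \<ge> l}"
      unfolding A_def by fastforce
    finally show "(\<lambda>n. prob (A n)) \<longlonglongrightarrow> prob {x \<in> space M. \<exists>j\<in>{m..}. \<bar>\<Sum>k = m..<j. d k x\<bar> \<ge> l}" .
    show "\<exists>N. \<forall>n\<ge>N. prob (A n) \<le> (\<Sum>k. v (k + m)) / l\<^sup>2"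
    proof (intro exI allI impI)
      fix n :: nat
      have "prob (A n) \<le> (\<Sum>k = m..<n. v k) / l\<^sup>2"
        unfolding A_def v_def by (rule maximal_inequality[OF l])
      also have "(\<Sum>k = m..<n. v k) = (\<Sum>k<n - m. v (k + m))"
        by (rule sum.reindex_bij_witness[of _ "\<lambda>k. k + m" "\<lambda>k. k - m"]) auto
      also have "\<dots> \<le> (\<Sum>k. v (k + m))"
        using v v_nonneg by (intro sum_le_suminf) (auto simp: summable_iff_shift)
      finally show "prob (A n) \<le> (\<Sum>k. v (k + m)) / l\<^sup>2"
        by (simp add: divide_right_mono)
    qed
  qed
  have "AE x in M. \<exists>m. \<forall>j\<ge>m. \<bar>\<Sum>k = m..<j. d k x\<bar> < l" if l: "l > 0" for l :: real
  proof -
    define B where "B = {x \<in> space M. \<forall>m. \<exists>j\<in>{m..}. \<bar>\<Sum>k = m..<j. d k x\<bar> \<ge> l}"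
    have [measurable]: "B \<in> events" unfolding B_def by measurable
    have "prob B \<le> 0"
    proof (rule LIMSEQ_le_const)
      have "(\<lambda>m. \<Sum>k. v (k + m)) \<longlonglongrightarrow> 0"
        using v by (rule suminf_exist_split2)
      then show "(\<lambda>m. (\<Sum>k. v (k + m)) / l\<^sup>2) \<longlonglongrightarrow> 0"
        using tendsto_divide_zero by blast
      \<comment> \<open>\<open>B\<close> lies in the oscillation event for every starting index
        \<open>m\<close>, so every tail bounds its probability.\<close>
      have "prob B \<le> (\<Sum>k. v (k + m)) / l\<^sup>2" for m
        by (rule order.trans[OF finite_measure_mono tail[OF l, of m]]) (auto simp: B_def)
      then show "\<exists>N. \<forall>m\<ge>N. prob B \<le> (\<Sum>k. v (k + m)) / l\<^sup>2" by blast
    qed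
    then have "prob B = 0" by (simp add: measure_le_0_iff)
    then have "AE x in M. x \<notin> B"
      by (subst AE_iff_measurable[of B]) (auto simp: emeasure_eq_measure B_def)
    then show ?thesis
      by (rule AE_mp) (auto intro!: AE_I2 simp: B_def not_le)
  qed
  then have "AE x in M. \<forall>i. \<exists>m. \<forall>j\<ge>m. \<bar>\<Sum>k = m..<j. d k x\<bar> < inverse (real (Suc i))"
    by (subst AE_all_countable) simp
  then show ?thesis
  proof (rule AE_mp, intro AE_I2 impI)
    fix x assume x: "\<forall>i. \<exists>m. \<forall>j\<ge>m. \<bar>\<Sum>k = m..<j. d k x\<bar> < inverse (real (Suc i))"
    show "summable (\<lambda>k. d k x)"
      unfolding summable_Cauchy
    proof (intro allI impI)
      fix e :: real assume "e > 0"
      then obtain i where i: "inverse (real (Suc i)) < e / 2"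
        using reals_Archimedean[of "e / 2"] by auto
      obtain m where m: "\<And>j. j \<ge> m \<Longrightarrow> \<bar>\<Sum>k = m..<j. d k x\<bar> < e / 2"
        using x i by (meson less_trans)
      have "norm (\<Sum>k = p..<q. d k x) < e" if p: "p \<ge> m" for p q
      proof (cases "p \<le> q")
        case True
        \<comment> \<open>A block from \<open>p\<close> to \<open>q\<close> is a difference of two
          sums started at \<open>m\<close>, each below \<open>e / 2\<close>.\<close>
        have "(\<Sum>k = m..<q. d k x) = (\<Sum>k = m..<p. d k x) + (\<Sum>k = p..<q. d k x)"
          using True p by (simp add: sum.atLeastLessThan_concat)
        then show ?thesis using m[of p] m[of q] True p by (auto simp: abs_real_def split: if_splits)
      next
        case False
        then show ?thesis using \<open>e > 0\<close> by simp
      qed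
      then show "\<exists>N. \<forall>p\<ge>N. \<forall>q. norm (\<Sum>k = p..<q. d k x) < e" by blast
    qed
  qed
qed

end

text \<open>Independence makes the joint law a product measure, so the second variable may be read
  at a separate sample point. The non-negative form yields integrability of squares, the signed form
  the centring.\<close>

lemma (in prob_space) indep_var_fubini:
  fixes f :: "'b \<times> 'b \<Rightarrow> real"
  assumes XY: "indep_var S X T Y" and f [measurable]: "f \<in> borel_measurable (S \<Otimes>\<^sub>M T)"
  shows nn_integral_indep_var:
      "(\<integral>\<^sup>+\<omega>. ennreal (f (X \<omega>, Y \<omega>)) \<partial>M) = (\<integral>\<^sup>+\<omega>. \<integral>\<^sup>+\<omega>'. ennreal (f (X \<omega>, Y \<omega>')) \<partial>M \<partial>M)"
    and integral_indep_var:
      "integrable M (\<lambda>\<omega>. f (X \<omega>, Y \<omega>)) \<Longrightarrow>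
        (\<integral>\<omega>. f (X \<omega>, Y \<omega>) \<partial>M) = (\<integral>\<omega>. \<integral>\<omega>'. f (X \<omega>, Y \<omega>') \<partial>M \<partial>M)"
proof -
  have X [measurable]: "X \<in> measurable M S" and Y [measurable]: "Y \<in> measurable M T"
    and eq: "distr M S X \<Otimes>\<^sub>M distr M T Y = distr M (S \<Otimes>\<^sub>M T) (\<lambda>\<omega>. (X \<omega>, Y \<omega>))"
    using XY by (simp_all add: indep_var_distribution_eq)
  interpret PX: prob_space "distr M S X" by (rule prob_space_distr) simp
  interpret PY: prob_space "distr M T Y" by (rule prob_space_distr) simp
  interpret P: pair_sigma_finite "distr M S X" "distr M T Y" ..
  have "(\<integral>\<^sup>+\<omega>. ennreal (f (X \<omega>, Y \<omega>)) \<partial>M) = (\<integral>\<^sup>+z. ennreal (f z) \<partial>(distr M S X \<Otimes>\<^sub>M distr M T Y))"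
    unfolding eq by (simp add: nn_integral_distr)
  also have "\<dots> = (\<integral>\<^sup>+x. \<integral>\<^sup>+y. ennreal (f (x, y)) \<partial>distr M T Y \<partial>distr M S X)"
    by (subst PY.nn_integral_fst[symmetric]) simp_all
  also have "\<dots> = (\<integral>\<^sup>+\<omega>. \<integral>\<^sup>+y. ennreal (f (X \<omega>, y)) \<partial>distr M T Y \<partial>M)"
    by (intro nn_integral_distr) simp_all
  also have "\<dots> = (\<integral>\<^sup>+\<omega>. \<integral>\<^sup>+\<omega>'. ennreal (f (X \<omega>, Y \<omega>')) \<partial>M \<partial>M)"
    using measurable_space[OF X] by (intro nn_integral_cong nn_integral_distr) simp_all
  finally show "(\<integral>\<^sup>+\<omega>. ennreal (f (X \<omega>, Y \<omega>)) \<partial>M) = (\<integral>\<^sup>+\<omega>. \<integral>\<^sup>+\<omega>'. ennreal (f (X \<omega>, Y \<omega>')) \<partial>M \<partial>M)" .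
  assume int: "integrable M (\<lambda>\<omega>. f (X \<omega>, Y \<omega>))"
  have int': "integrable (distr M S X \<Otimes>\<^sub>M distr M T Y) f"
    unfolding eq using int by (simp add: integrable_distr_eq)
  have "(\<integral>\<omega>. f (X \<omega>, Y \<omega>) \<partial>M) = (\<integral>z. f z \<partial>(distr M S X \<Otimes>\<^sub>M distr M T Y))"
    unfolding eq by (simp add: integral_distr)
  also have "\<dots> = (\<integral>x. \<integral>y. f (x, y) \<partial>distr M T Y \<partial>distr M S X)"
    by (rule P.integral_fst'[OF int', symmetric])
  also have "\<dots> = (\<integral>\<omega>. \<integral>y. f (X \<omega>, y) \<partial>distr M T Y \<partial>M)"
    by (intro integral_distr) simp_all
  also have "\<dots> = (\<integral>\<omega>. \<integral>\<omega>'. f (X \<omega>, Y \<omega>') \<partial>M \<partial>M)"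
    using measurable_space[OF X] by (intro Bochner_Integration.integral_cong refl integral_distr) simp_all
  finally show "(\<integral>\<omega>. f (X \<omega>, Y \<omega>) \<partial>M) = (\<integral>\<omega>. \<integral>\<omega>'. f (X \<omega>, Y \<omega>') \<partial>M \<partial>M)" .
qed

lemma (in prob_space) expectation_sum_squared:
  fixes f :: "'i \<Rightarrow> 'a \<Rightarrow> real"
  assumes fin: "finite I"
    and meas [measurable]: "\<And>i. i \<in> I \<Longrightarrow> f i \<in> borel_measurable M"
    and sq: "\<And>i. i \<in> I \<Longrightarrow> integrable M (\<lambda>x. (f i x)\<^sup>2)"
    and uncorr: "\<And>i j. i \<in> I \<Longrightarrow> j \<in> I \<Longrightarrow> i \<noteq> j \<Longrightarrow> (\<integral>x. f i x * f j x \<partial>M) = 0"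
  shows "integrable M (\<lambda>x. (\<Sum>i\<in>I. f i x)\<^sup>2)"
    and "(\<integral>x. (\<Sum>i\<in>I. f i x)\<^sup>2 \<partial>M) = (\<Sum>i\<in>I. \<integral>x. (f i x)\<^sup>2 \<partial>M)"
proof -
  have int: "integrable M (\<lambda>x. f i x * f j x)" if "i \<in> I" "j \<in> I" for i j
  proof (rule Bochner_Integration.integrable_bound)
    show "integrable M (\<lambda>x. (f i x)\<^sup>2 + (f j x)\<^sup>2)"
      using sq that by auto
    show "AE x in M. norm (f i x * f j x) \<le> norm ((f i x)\<^sup>2 + (f j x)\<^sup>2)"
      using abs_mult_le_sum_squares[of "f i _" "f j _"] by simp
  qed (use that in simp)
  have eq: "(\<Sum>i\<in>I. f i x)\<^sup>2 = (\<Sum>i\<in>I. \<Sum>j\<in>I. f i x * f j x)" for x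
    by (simp add: power2_eq_square sum_product)
  show "integrable M (\<lambda>x. (\<Sum>i\<in>I. f i x)\<^sup>2)"
    unfolding eq using int by auto
  have "(\<integral>x. (\<Sum>i\<in>I. f i x)\<^sup>2 \<partial>M) = (\<Sum>i\<in>I. \<Sum>j\<in>I. \<integral>x. f i x * f j x \<partial>M)"
    unfolding eq using int by (simp add: Bochner_Integration.integral_sum)
  also have "\<dots> = (\<Sum>i\<in>I. \<Sum>j\<in>I. if j = i then \<integral>x. (f i x)\<^sup>2 \<partial>M else 0)"
    using uncorr by (intro sum.cong) (auto simp: power2_eq_square)
  also have "\<dots> = (\<Sum>i\<in>I. \<integral>x. (f i x)\<^sup>2 \<partial>M)"
    using fin by simp
  finally show "(\<integral>x. (\<Sum>i\<in>I. f i x)\<^sup>2 \<partial>M) = (\<Sum>i\<in>I. \<integral>x. (f i x)\<^sup>2 \<partial>M)" .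
qed

section \<open>The INAR(1) process\<close>

text \<open>The coordinates known at time \<open>k\<close>; \<open>present k\<close> holds those of
  the step to \<open>k + 1\<close>. Whole rows of counting variables are taken because the number
  actually summed is random.\<close>

definition past :: "nat \<Rightarrow> inar_idx set" where
  "past k = {IX0} \<union> IEps ` {..k} \<union> (\<Union>l\<in>{..k}. range (IXi l))"

definition present :: "nat \<Rightarrow> inar_idx set" where
  "present k = {IEps (Suc k)} \<union> range (IXi (Suc k))"

lemma past_mono: "j \<le> k \<Longrightarrow> past j \<subseteq> past k"
  unfolding past_def by force

lemma past_Suc: "past (Suc k) = past k \<union> present k"
  unfolding past_def present_def by (auto simp: atMost_Suc)

lemma past_present_disjoint: "past k \<inter> present k = {}"
  unfolding past_def present_def by auto

lemma inarX_measurable: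
  assumes "\<And>i. i \<in> past k \<Longrightarrow> Z i \<in> measurable N (count_space UNIV)"
  shows "inarX Z k \<in> measurable N (count_space UNIV)"
  using assms
proof (induction k)
  case 0
  have "inarX Z 0 = Z IX0" by (rule ext) simp
  then show ?case using 0 by (simp add: past_def)
next
  case (Suc k)
  have [measurable]: "inarX Z k \<in> measurable N (count_space UNIV)"
    using Suc past_Suc by auto
  have [measurable]: "Z (IXi (Suc k) j) \<in> measurable N (count_space UNIV)"
     "Z (IEps (Suc k)) \<in> measurable N (count_space UNIV)" for j
    using Suc.prems unfolding past_Suc present_def by auto
  \<comment> \<open>The upper summation limit is random but takes countably many values, so it can
    be fixed first.\<close>
  have "(\<lambda>\<omega>. (\<Sum>j = 1..inarX Z k \<omega>. Z (IXi (Suc k) j) \<omega>) + Z (IEps (Suc k)) \<omega>)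
      \<in> measurable N (count_space UNIV)"
    by (rule measurable_compose_countable[of "\<lambda>m \<omega>. (\<Sum>j = 1..m. Z (IXi (Suc k) j) \<omega>) + Z (IEps (Suc k)) \<omega>"])
      measurable
  also have "(\<lambda>\<omega>. (\<Sum>j = 1..inarX Z k \<omega>. Z (IXi (Suc k) j) \<omega>) + Z (IEps (Suc k)) \<omega>) = inarX Z (Suc k)"
    by (rule ext) simp
  finally show ?case .
qed

text \<open>Families and sample points may both differ, so that the process can be compared with the
  same recursion run on coordinate projections.\<close>

lemma inarX_cong:
  assumes "\<And>i. i \<in> past k \<Longrightarrow> Z i \<omega> = Z' i \<omega>'"
  shows "inarX Z k \<omega> = inarX Z' k \<omega>'"
  using assms
proof (induction k)
  case (Suc k)
  then have "inarX Z k \<omega> = inarX Z' k \<omega>'" using past_Suc by auto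
  then show ?case
    using Suc.prems unfolding past_Suc present_def by simp
qed (simp add: past_def)

text \<open>The population size \<open>m\<close> is a separate argument so that it can be frozen
  while the shocks are integrated; at \<open>m = X_k\<close> this is the martingale
  difference.\<close>

definition innov :: "real \<Rightarrow> real \<Rightarrow> (inar_idx \<Rightarrow> 'a \<Rightarrow> nat) \<Rightarrow> nat \<Rightarrow> nat \<Rightarrow> 'a \<Rightarrow> real" where
  "innov \<alpha> mu Z k m \<omega> =
    (\<Sum>j = 1..m. real (Z (IXi (Suc k) j) \<omega>) - \<alpha>) + (real (Z (IEps (Suc k)) \<omega>) - mu)"

lemma innov_inarX:
  "innov \<alpha> mu Z k (inarX Z k \<omega>) \<omega> = real (inarX Z (Suc k) \<omega>) - \<alpha> * real (inarX Z k \<omega>) - mu"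
  by (simp add: innov_def sum_subtractf)

lemma innov_measurable:
  assumes "\<And>i. i \<in> present k \<Longrightarrow> Z i \<in> measurable N (count_space UNIV)"
    and [measurable]: "m \<in> measurable N (count_space UNIV)"
  shows "(\<lambda>\<omega>. innov \<alpha> mu Z k (m \<omega>) \<omega>) \<in> borel_measurable N"
proof (rule measurable_compose_countable[OF _ assms(2)])
  have [measurable]: "Z (IXi (Suc k) j) \<in> measurable N (count_space UNIV)"
     "Z (IEps (Suc k)) \<in> measurable N (count_space UNIV)" for j
    using assms(1) unfolding present_def by auto
  show "innov \<alpha> mu Z k i \<in> borel_measurable N" for i
    unfolding innov_def by measurable
qed

text \<open>The summand 1 gives \<open>1 + X\<^sub>k \<le> 2 sqrt (sqsum (Suc k))\<close>, used in the variance bound.\<close>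
definition sqsum :: "(inar_idx \<Rightarrow> 'a \<Rightarrow> nat) \<Rightarrow> nat \<Rightarrow> 'a \<Rightarrow> real" where
  "sqsum Z k \<omega> = 1 + (\<Sum>j<k. (real (inarX Z j \<omega>))\<^sup>2)"

lemma sqsum_Suc: "sqsum Z (Suc k) \<omega> = sqsum Z k \<omega> + (real (inarX Z k \<omega>))\<^sup>2"
  by (simp add: sqsum_def)

lemma sqsum_ge_1: "sqsum Z k \<omega> \<ge> 1"
  by (simp add: sqsum_def sum_nonneg)

lemma sqsum_mono: "incseq (\<lambda>k. sqsum Z k \<omega>)"
  by (intro incseq_SucI) (simp add: sqsum_Suc)

text \<open>The normaliser already contains the square of \<open>X_k\<close>, yet it is determined
  by the past at time \<open>k\<close>, so the weight is predictable.\<close>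

definition weight :: "(inar_idx \<Rightarrow> 'a \<Rightarrow> nat) \<Rightarrow> nat \<Rightarrow> 'a \<Rightarrow> real" where
  "weight Z k \<omega> = real (inarX Z k \<omega>) / sqsum Z (Suc k) \<omega>"

lemma weight_measurable:
  assumes "\<And>i. i \<in> past k \<Longrightarrow> Z i \<in> measurable N (count_space UNIV)"
  shows "weight Z k \<in> borel_measurable N"
proof -
  have "(\<lambda>\<omega>. real (inarX Z j \<omega>)) \<in> borel_measurable N" if "j \<le> k" for j
    using assms past_mono[OF that] by (intro measurable_compose[OF inarX_measurable]) auto
  then show ?thesis
    unfolding weight_def sqsum_def
    by (intro borel_measurable_divide borel_measurable_add borel_measurable_sum borel_measurable_power) auto
qed

lemma weight_cong:
  assumes "\<And>i. i \<in> past k \<Longrightarrow> Z i \<omega> = Z' i \<omega>'"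
  shows "weight Z k \<omega> = weight Z' k \<omega>'"
proof -
  have "inarX Z j \<omega> = inarX Z' j \<omega>'" if "j \<le> k" for j
    using assms past_mono[OF that] by (intro inarX_cong) auto
  then show ?thesis by (simp add: weight_def sqsum_def)
qed

text \<open>Since \<open>X\<^sub>k \<le> sqrt (sqsum (Suc k))\<close>, the conditional variance of the weighted innovation is
  dominated by a telescoping sequence; this is why second moments suffice.\<close>
lemma weight_sq_bound:
  "(weight Z k \<omega>)\<^sup>2 * (1 + real (inarX Z k \<omega>))
     \<le> 4 * (1 / sqrt (sqsum Z k \<omega>) - 1 / sqrt (sqsum Z (Suc k) \<omega>))"
proof -
  define a b x where "a = sqrt (sqsum Z k \<omega>)" and "b = sqrt (sqsum Z (Suc k) \<omega>)"
    and "x = real (inarX Z k \<omega>)"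
  have V: "sqsum Z (Suc k) \<omega> = b\<^sup>2" "sqsum Z k \<omega> = a\<^sup>2"
    unfolding a_def b_def using sqsum_ge_1[of Z "Suc k" \<omega>] sqsum_ge_1[of Z k \<omega>] by simp_all
  have a: "a \<ge> 1" and b: "b \<ge> 1"
    unfolding a_def b_def using sqsum_ge_1[of Z k \<omega>] sqsum_ge_1[of Z "Suc k" \<omega>] by simp_all
  have ab: "a \<le> b"
    unfolding a_def b_def using incseq_SucD[OF sqsum_mono[of Z \<omega>], of k] by simp
  have x2: "x\<^sup>2 = b\<^sup>2 - a\<^sup>2"
    unfolding V[symmetric] sqsum_Suc x_def by simp
  have x0: "x \<ge> 0" by (simp add: x_def)
  have "x\<^sup>2 \<le> b\<^sup>2" unfolding x2 by simp
  then have xb: "x \<le> b" using b by (intro power2_le_imp_le[of x b]) linarith+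
  \<comment> \<open>The first factor comes from \<open>x\<^sup>2 = (b - a) * (b + a)\<close> with
    \<open>a \<le> b\<close>, the second from \<open>1 \<le> b\<close> and
    \<open>x \<le> b\<close>.\<close>
  have "x\<^sup>2 * (1 + x) \<le> ((b - a) * (2 * b)) * (2 * b)"
  proof (rule mult_mono)
    have "x\<^sup>2 = (b - a) * (b + a)" unfolding x2 by algebra
    also have "\<dots> \<le> (b - a) * (2 * b)" using ab by (intro mult_left_mono) auto
    finally show "x\<^sup>2 \<le> (b - a) * (2 * b)" .
  qed (use xb b ab x0 in auto)
  then have "x\<^sup>2 * (1 + x) / b ^ 4 \<le> ((b - a) * (2 * b)) * (2 * b) / b ^ 4"
    using b by (intro divide_right_mono) auto
  also have "\<dots> = 4 * ((b - a) / (b * b))"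
  proof -
    have "((b - a) * (2 * b)) * (2 * b) / b ^ 4 = (b * b) * (4 * (b - a)) / ((b * b) * (b * b))"
      by (simp add: power4_eq_xxxx mult_ac)
    also have "\<dots> = 4 * (b - a) / (b * b)"
      using b by (subst mult_divide_mult_cancel_left) auto
    finally show ?thesis by simp
  qed
  also have "\<dots> \<le> 4 * ((b - a) / (a * b))"
  proof -
    \<comment> \<open>Weakening the denominator from \<open>b * b\<close> to \<open>a * b\<close> is
      what produces the telescoping difference of reciprocals.\<close>
    have "a * b \<le> b * b" using ab b by (intro mult_right_mono) auto
    moreover have "0 < a * b" using a b by (intro mult_pos_pos) auto
    ultimately have "(b - a) / (b * b) \<le> (b - a) / (a * b)" using ab by (intro divide_left_mono) auto
    then show ?thesis by (rule mult_left_mono) simp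
  qed
  also have "\<dots> = 4 * (1 / a - 1 / b)"
  proof -
    have "a \<noteq> 0" "b \<noteq> 0" using a b by auto
    then have "1 / a - 1 / b = (b - a) / (a * b)" by (simp add: diff_frac_eq)
    then show ?thesis by simp
  qed
  finally have *: "x\<^sup>2 * (1 + x) / b ^ 4 \<le> 4 * (1 / a - 1 / b)" .
  have "(weight Z k \<omega>)\<^sup>2 = x\<^sup>2 / b ^ 4"
    unfolding weight_def V(1) x_def[symmetric] power_divide by (simp flip: power_mult)
  then show ?thesis
    using * unfolding x_def[symmetric] a_def[symmetric] b_def[symmetric] by simp
qed

section \<open>Probabilistic model and moments of the innovations\<close>

locale inar = prob_space M for M :: "'a measure" +
  fixes Z :: "inar_idx \<Rightarrow> 'a \<Rightarrow> nat" and \<alpha> mu :: real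
  assumes indep: "indep_vars (\<lambda>_. count_space UNIV) Z UNIV"
    and eps_ident: "\<And>k. k \<ge> 1 \<Longrightarrow>
          distr M (count_space UNIV) (Z (IEps k)) = distr M (count_space UNIV) (Z (IEps 1))"
    and eps_sq: "integrable M (\<lambda>\<omega>. (real (Z (IEps 1) \<omega>))\<^sup>2)"
    and eps_nz: "prob {\<omega> \<in> space M. Z (IEps 1) \<omega> \<noteq> 0} > 0"
    and mu_def: "mu = expectation (\<lambda>\<omega>. real (Z (IEps 1) \<omega>))"
    and xi_bin: "\<And>k j \<omega>. k \<ge> 1 \<Longrightarrow> j \<ge> 1 \<Longrightarrow> \<omega> \<in> space M \<Longrightarrow> Z (IXi k j) \<omega> \<le> 1"
    and xi_mean: "\<And>k j. k \<ge> 1 \<Longrightarrow> j \<ge> 1 \<Longrightarrow> prob {\<omega> \<in> space M. Z (IXi k j) \<omega> = 1} = \<alpha>"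
begin

lemma Z_measurable [measurable]: "Z i \<in> measurable M (count_space UNIV)"
  using indep unfolding indep_vars_def by auto

lemma eps_distr:
  fixes f :: "nat \<Rightarrow> real"
  assumes "k \<ge> 1"
  shows "integrable M (\<lambda>\<omega>. f (Z (IEps k) \<omega>)) \<longleftrightarrow> integrable M (\<lambda>\<omega>. f (Z (IEps 1) \<omega>))"
    and "expectation (\<lambda>\<omega>. f (Z (IEps k) \<omega>)) = expectation (\<lambda>\<omega>. f (Z (IEps 1) \<omega>))"
proof -
  have *: "integrable M (\<lambda>\<omega>. f (Z (IEps k) \<omega>)) = integrable (distr M (count_space UNIV) (Z (IEps k))) f"
    "expectation (\<lambda>\<omega>. f (Z (IEps k) \<omega>)) = integral\<^sup>L (distr M (count_space UNIV) (Z (IEps k))) f" for k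
    by (simp_all add: integrable_distr_eq integral_distr)
  show "integrable M (\<lambda>\<omega>. f (Z (IEps k) \<omega>)) \<longleftrightarrow> integrable M (\<lambda>\<omega>. f (Z (IEps 1) \<omega>))"
    and "expectation (\<lambda>\<omega>. f (Z (IEps k) \<omega>)) = expectation (\<lambda>\<omega>. f (Z (IEps 1) \<omega>))"
    unfolding *(1)[of k] *(2)[of k] eps_ident[OF assms] by (simp_all add: *)
qed

lemma eps_integrable: "integrable M (\<lambda>\<omega>. real (Z (IEps 1) \<omega>))"
  using square_integrable_imp_integrable[OF _ eps_sq] by simp

lemma eps_centred:
  assumes "k \<ge> 1"
  shows "integrable M (\<lambda>\<omega>. real (Z (IEps k) \<omega>) - mu)"
    and "expectation (\<lambda>\<omega>. real (Z (IEps k) \<omega>) - mu) = 0"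
    and "integrable M (\<lambda>\<omega>. (real (Z (IEps k) \<omega>) - mu)\<^sup>2)"
    and "expectation (\<lambda>\<omega>. (real (Z (IEps k) \<omega>) - mu)\<^sup>2) = expectation (\<lambda>\<omega>. (real (Z (IEps 1) \<omega>) - mu)\<^sup>2)"
proof -
  note d = eps_distr[OF assms, of "\<lambda>x. real x - mu"] eps_distr[OF assms, of "\<lambda>x. (real x - mu)\<^sup>2"]
  show "integrable M (\<lambda>\<omega>. real (Z (IEps k) \<omega>) - mu)"
    unfolding d(1) using eps_integrable by simp
  show "expectation (\<lambda>\<omega>. real (Z (IEps k) \<omega>) - mu) = 0"
    unfolding d(2) using eps_integrable by (simp add: mu_def prob_space)
  show "integrable M (\<lambda>\<omega>. (real (Z (IEps k) \<omega>) - mu)\<^sup>2)"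
    unfolding d(3) using eps_integrable eps_sq by (simp add: power2_diff)
  show "expectation (\<lambda>\<omega>. (real (Z (IEps k) \<omega>) - mu)\<^sup>2) = expectation (\<lambda>\<omega>. (real (Z (IEps 1) \<omega>) - mu)\<^sup>2)"
    by (rule d(4))
qed

lemma xi_centred:
  assumes k: "k \<ge> 1" and j: "j \<ge> 1"
  shows "integrable M (\<lambda>\<omega>. real (Z (IXi k j) \<omega>) - \<alpha>)"
    and "expectation (\<lambda>\<omega>. real (Z (IXi k j) \<omega>) - \<alpha>) = 0"
    and "integrable M (\<lambda>\<omega>. (real (Z (IXi k j) \<omega>) - \<alpha>)\<^sup>2)"
    and "expectation (\<lambda>\<omega>. (real (Z (IXi k j) \<omega>) - \<alpha>)\<^sup>2) \<le> 1"
proof -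
  have int: "integrable M (\<lambda>\<omega>. real (Z (IXi k j) \<omega>))"
    using xi_bin[OF k j] by (intro integrable_const_bound[of _ 1]) auto
  have "expectation (\<lambda>\<omega>. real (Z (IXi k j) \<omega>)) = expectation (indicator {\<omega> \<in> space M. Z (IXi k j) \<omega> = 1})"
    using xi_bin[OF k j] by (intro Bochner_Integration.integral_cong) (auto simp: indicator_def le_Suc_eq)
  also have "\<dots> = \<alpha>"
    using xi_mean[OF k j] by simp
  finally have mean: "expectation (\<lambda>\<omega>. real (Z (IXi k j) \<omega>)) = \<alpha>" .
  show "integrable M (\<lambda>\<omega>. real (Z (IXi k j) \<omega>) - \<alpha>)" using int by simp
  show "expectation (\<lambda>\<omega>. real (Z (IXi k j) \<omega>) - \<alpha>) = 0" using int mean by (simp add: prob_space)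
  have "0 \<le> \<alpha>" "\<alpha> \<le> 1" using xi_mean[OF k j] by (auto simp flip: xi_mean[OF k j])
  then have bound: "(real (Z (IXi k j) \<omega>) - \<alpha>)\<^sup>2 \<le> 1" if "\<omega> \<in> space M" for \<omega>
    using xi_bin[OF k j that] by (intro abs_square_le_1[THEN iffD2]) (auto simp: abs_le_iff)
  show sq: "integrable M (\<lambda>\<omega>. (real (Z (IXi k j) \<omega>) - \<alpha>)\<^sup>2)"
    using bound by (intro integrable_const_bound[of _ 1]) auto
  show "expectation (\<lambda>\<omega>. (real (Z (IXi k j) \<omega>) - \<alpha>)\<^sup>2) \<le> 1"
    using integral_mono[OF sq _ bound] by (simp add: prob_space)
qed

text \<open>For fixed \<open>m\<close> the innovation is a sum of independent centred terms:
  \<open>m\<close> Bernoulli terms of variance at most 1 and one \<open>IEps\<close> term. Hence the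
  variance grows at most linearly in \<open>m\<close>.\<close>

lemma innov_moments:
  shows innov_mean: "expectation (innov \<alpha> mu Z k m) = 0"
    and innov_sq_integrable: "integrable M (\<lambda>\<omega>. (innov \<alpha> mu Z k m \<omega>)\<^sup>2)"
    and innov_sq_le: "expectation (\<lambda>\<omega>. (innov \<alpha> mu Z k m \<omega>)\<^sup>2)
      \<le> (1 + expectation (\<lambda>\<omega>. (real (Z (IEps 1) \<omega>) - mu)\<^sup>2)) * (1 + real m)"
proof -
  \<comment> \<open>Both kinds of summand form one family indexed within \<open>inar_idx\<close>, so
    joint independence of \<open>Z\<close> gives all pairwise correlations at once.\<close>
  define I where "I = insert (IEps (Suc k)) (IXi (Suc k) ` {1..m})"
  define f where "f i \<omega> = real (Z i \<omega>) - (case i of IEps _ \<Rightarrow> mu | _ \<Rightarrow> \<alpha>)" for i \<omega>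
  have fin: "finite I" by (simp add: I_def)
  have [measurable]: "f i \<in> borel_measurable M" for i unfolding f_def by simp
  have sumI: "(\<Sum>i\<in>I. h i) = (\<Sum>j = 1..m. h (IXi (Suc k) j)) + h (IEps (Suc k))" for h :: "inar_idx \<Rightarrow> real"
  proof -
    have "sum h (IXi (Suc k) ` {1..m}) = (\<Sum>j = 1..m. h (IXi (Suc k) j))"
      by (subst sum.reindex) (auto simp: inj_on_def)
    then show ?thesis unfolding I_def by (subst sum.insert) auto
  qed
  have innov_eq: "innov \<alpha> mu Z k m \<omega> = (\<Sum>i\<in>I. f i \<omega>)" for \<omega>
    unfolding sumI by (simp add: innov_def f_def)
  have int: "integrable M (f i)" and mean: "expectation (f i) = 0"
    and sq: "integrable M (\<lambda>\<omega>. (f i \<omega>)\<^sup>2)" if "i \<in> I" for i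
    using that eps_centred[of "Suc k"] xi_centred[of "Suc k"] unfolding I_def f_def by auto
  have indep_f: "indep_vars (\<lambda>_. borel) f UNIV"
    unfolding f_def by (rule indep_vars_compose2[OF indep]) simp
  have uncorr: "expectation (\<lambda>\<omega>. f i \<omega> * f j \<omega>) = 0" if ij: "i \<in> I" "j \<in> I" "i \<noteq> j" for i j
    using indep_vars_lebesgue_integral[of "{i, j}" f] indep_vars_subset[OF indep_f, of "{i, j}"] ij int mean
    by auto
  show "expectation (innov \<alpha> mu Z k m) = 0"
    unfolding innov_eq using int mean by (simp add: Bochner_Integration.integral_sum)
  note es = expectation_sum_squared[of I f, OF fin _ sq uncorr]
  show "integrable M (\<lambda>\<omega>. (innov \<alpha> mu Z k m \<omega>)\<^sup>2)"
    unfolding innov_eq by (rule es(1)) auto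
  define v where "v = expectation (\<lambda>\<omega>. (real (Z (IEps 1) \<omega>) - mu)\<^sup>2)"
  have "expectation (\<lambda>\<omega>. (innov \<alpha> mu Z k m \<omega>)\<^sup>2) = (\<Sum>i\<in>I. expectation (\<lambda>\<omega>. (f i \<omega>)\<^sup>2))"
    unfolding innov_eq by (rule es(2)) auto
  also have "\<dots> \<le> (\<Sum>j = 1..m. 1) + v"
    unfolding sumI f_def v_def using eps_centred(4)[of "Suc k"] xi_centred(4)[of "Suc k"]
    by (intro add_mono sum_mono) auto
  also have "\<dots> \<le> (1 + v) * (1 + real m)"
    by (simp add: algebra_simps v_def)
  finally show "expectation (\<lambda>\<omega>. (innov \<alpha> mu Z k m \<omega>)\<^sup>2) \<le> (1 + v) * (1 + real m)" .
qed

section \<open>Natural filtration and normalised martingale differences\<close>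

definition hist :: "nat \<Rightarrow> 'a \<Rightarrow> inar_idx \<Rightarrow> nat" where
  "hist k \<omega> = restrict (\<lambda>i. Z i \<omega>) (past k)"

definition shock :: "nat \<Rightarrow> 'a \<Rightarrow> inar_idx \<Rightarrow> nat" where
  "shock k \<omega> = restrict (\<lambda>i. Z i \<omega>) (present k)"

definition F :: "nat \<Rightarrow> 'a measure" where
  "F k = vimage_algebra (space M) (hist k) (PiM (past k) (\<lambda>_. count_space UNIV))"

definition d :: "nat \<Rightarrow> 'a \<Rightarrow> real" where
  "d k \<omega> = weight Z k \<omega> * innov \<alpha> mu Z k (inarX Z k \<omega>) \<omega>"

lemma hist_measurable: "hist k \<in> measurable M (PiM (past k) (\<lambda>_. count_space UNIV))"
  unfolding hist_def by (intro measurable_restrict Z_measurable)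

lemma hist_shock_indep:
  "indep_var (PiM (past k) (\<lambda>_. count_space UNIV)) (hist k) (PiM (present k) (\<lambda>_. count_space UNIV)) (shock k)"
  unfolding hist_def shock_def by (rule indep_var_restrict[OF indep past_present_disjoint]) auto

lemma F_subalgebra: "subalgebra M (F k)"
  unfolding subalgebra_def F_def using sets_image_in_sets[OF refl hist_measurable] by simp

lemma Z_F_measurable:
  assumes "i \<in> past k"
  shows "Z i \<in> measurable (F k) (count_space UNIV)"
proof -
  have "hist k \<in> measurable (F k) (PiM (past k) (\<lambda>_. count_space UNIV))"
    unfolding F_def using measurable_space[OF hist_measurable]
    by (intro measurable_vimage_algebra1) auto
  then have "(\<lambda>\<omega>. hist k \<omega> i) \<in> measurable (F k) (count_space UNIV)"
    by (rule measurable_compose) (rule measurable_component_singleton[OF assms])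
  then show ?thesis using assms by (simp add: hist_def)
qed

lemma F_mono: "sets (F k) \<subseteq> sets (F (Suc k))"
  unfolding F_def[of k]
proof (rule sets_image_in_sets)
  show "space (F (Suc k)) = space M" by (simp add: F_def)
  show "hist k \<in> measurable (F (Suc k)) (PiM (past k) (\<lambda>_. count_space UNIV))"
    unfolding hist_def using past_Suc by (intro measurable_restrict Z_F_measurable) auto
qed

lemma d_F_measurable: "d k \<in> borel_measurable (F (Suc k))"
proof -
  have Z: "Z i \<in> measurable (F (Suc k)) (count_space UNIV)" if "i \<in> past k \<union> present k" for i
    using that by (intro Z_F_measurable) (simp add: past_Suc)
  have "weight Z k \<in> borel_measurable (F (Suc k))"
    using Z by (intro weight_measurable) auto
  moreover have "(\<lambda>\<omega>. innov \<alpha> mu Z k (inarX Z k \<omega>) \<omega>) \<in> borel_measurable (F (Suc k))"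
    using Z by (intro innov_measurable inarX_measurable) auto
  ultimately show ?thesis unfolding d_def by simp
qed

lemma d_borel_measurable [measurable]: "d k \<in> borel_measurable M"
  using d_F_measurable F_subalgebra measurable_from_subalg by blast

text \<open>Applying the recursion to the coordinate projections exhibits \<open>X\<^sub>k\<close> as a function of the history,
  so that independence and Fubini can integrate out the shocks at a fixed history.\<close>
abbreviation coord :: "inar_idx \<Rightarrow> (inar_idx \<Rightarrow> nat) \<Rightarrow> nat" where
  "coord i f \<equiv> f i"

lemma weight_hist: "weight coord k (hist k \<omega>) = weight Z k \<omega>"
  by (rule weight_cong) (simp add: hist_def)

lemma inarX_hist: "inarX coord k (hist k \<omega>) = inarX Z k \<omega>"
  by (rule inarX_cong) (simp add: hist_def)

lemma innov_shock: "innov \<alpha> mu coord k m (shock k \<omega>) = innov \<alpha> mu Z k m \<omega>"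
  by (simp add: innov_def shock_def present_def)

text \<open>The increment as a function of history and shock. Taken at the history of one sample
  point and the shock of another, it keeps weight and population size fixed while the innovation
  varies.\<close>

definition dfun :: "nat \<Rightarrow> (inar_idx \<Rightarrow> nat) \<times> (inar_idx \<Rightarrow> nat) \<Rightarrow> real" where
  "dfun k z = weight coord k (fst z) * innov \<alpha> mu coord k (inarX coord k (fst z)) (snd z)"

lemma dfun_hist_shock:
  "dfun k (hist k \<omega>, shock k \<omega>') = weight Z k \<omega> * innov \<alpha> mu Z k (inarX Z k \<omega>) \<omega>'"
  by (simp add: dfun_def weight_hist inarX_hist innov_shock)

lemma dfun_measurable [measurable]:
  "dfun k \<in> borel_measurable (PiM (past k) (\<lambda>_. count_space UNIV) \<Otimes>\<^sub>M PiM (present k) (\<lambda>_. count_space UNIV))"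
  (is "_ \<in> borel_measurable (?A \<Otimes>\<^sub>M ?B)")
proof -
  have c: "coord i \<in> measurable (PiM S (\<lambda>_. count_space UNIV)) (count_space UNIV)" if "i \<in> S" for i S
    using that by (rule measurable_component_singleton)
  have [measurable]: "weight coord k \<in> borel_measurable ?A" "inarX coord k \<in> measurable ?A (count_space UNIV)"
    by (intro weight_measurable inarX_measurable c; simp)+
  \<comment> \<open>The second component is viewed as a family of variables on the pair space, and
    the population size as a variable read from the first.\<close>
  have "(\<lambda>z. innov \<alpha> mu (\<lambda>i z. snd z i) k (inarX coord k (fst z)) z) \<in> borel_measurable (?A \<Otimes>\<^sub>M ?B)"
    by (intro innov_measurable measurable_compose[OF measurable_snd c]) measurable
  then have [measurable]: "(\<lambda>z. innov \<alpha> mu coord k (inarX coord k (fst z)) (snd z)) \<in> borel_measurable (?A \<Otimes>\<^sub>M ?B)"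
    by (simp add: innov_def)
  show ?thesis unfolding dfun_def by measurable
qed

text \<open>A decreasing potential with values in the unit interval, whose decrements dominate the
  variances of \<open>d\<close>.\<close>

definition U :: "nat \<Rightarrow> 'a \<Rightarrow> real" where
  "U k \<omega> = 1 / sqrt (sqsum Z k \<omega>)"

lemma U_integrable: "integrable M (U k)"
proof (rule integrable_const_bound[of _ 1])
  show "AE \<omega> in M. norm (U k \<omega>) \<le> 1"
  proof (intro AE_I2)
    fix \<omega>
    have "1 \<le> sqrt (sqsum Z k \<omega>)" using sqsum_ge_1[of Z k \<omega>] by simp
    then show "norm (U k \<omega>) \<le> 1" by (simp add: U_def divide_le_eq)
  qed
  have [measurable]: "inarX Z j \<in> measurable M (count_space UNIV)" for j
    by (rule inarX_measurable) simp
  show "U k \<in> borel_measurable M" unfolding U_def sqsum_def by measurable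
qed

text \<open>At a fixed history the squared innovation averages to at most a multiple of
  \<open>1 + X_k\<close>; \<open>weight_sq_bound\<close> turns this into a decrement of
  \<open>U\<close>. Working with non-negative integrals delivers integrability along the
  way.\<close>

lemma d_sq_moment:
  shows d_sq_integrable: "integrable M (\<lambda>\<omega>. (d k \<omega>)\<^sup>2)"
    and d_sq_le: "\<exists>K\<ge>0. \<forall>k. expectation (\<lambda>\<omega>. (d k \<omega>)\<^sup>2) \<le> K * (expectation (U k) - expectation (U (Suc k)))"
proof -
  define v where "v = expectation (\<lambda>\<omega>. (real (Z (IEps 1) \<omega>) - mu)\<^sup>2)"
  have v: "v \<ge> 0" by (simp add: v_def)
  have Unn: "U k \<omega> - U (Suc k) \<omega> \<ge> 0" for k \<omega>
    using incseq_SucD[OF sqsum_mono[of Z \<omega>], of k] sqsum_ge_1[of Z k \<omega>]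
    by (simp add: U_def divide_left_mono)
  have nn: "(\<integral>\<^sup>+\<omega>. ennreal ((d k \<omega>)\<^sup>2) \<partial>M) \<le> (\<integral>\<^sup>+\<omega>. ennreal (4 * (1 + v) * (U k \<omega> - U (Suc k) \<omega>)) \<partial>M)" for k
  proof -
    have "(\<integral>\<^sup>+\<omega>. ennreal ((d k \<omega>)\<^sup>2) \<partial>M) = (\<integral>\<^sup>+\<omega>. ennreal ((dfun k (hist k \<omega>, shock k \<omega>))\<^sup>2) \<partial>M)"
      by (simp add: dfun_hist_shock d_def)
    also have "\<dots> = (\<integral>\<^sup>+\<omega>. \<integral>\<^sup>+\<omega>'. ennreal ((dfun k (hist k \<omega>, shock k \<omega>'))\<^sup>2) \<partial>M \<partial>M)"
      by (rule nn_integral_indep_var[OF hist_shock_indep]) measurable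
    also have "\<dots> \<le> (\<integral>\<^sup>+\<omega>. ennreal (4 * (1 + v) * (U k \<omega> - U (Suc k) \<omega>)) \<partial>M)"
    proof (rule nn_integral_mono)
      fix \<omega>
      let ?w = "(weight Z k \<omega>)\<^sup>2" and ?m = "inarX Z k \<omega>"
      have "(\<integral>\<^sup>+\<omega>'. ennreal ((dfun k (hist k \<omega>, shock k \<omega>'))\<^sup>2) \<partial>M)
          = (\<integral>\<^sup>+\<omega>'. ennreal (?w * (innov \<alpha> mu Z k ?m \<omega>')\<^sup>2) \<partial>M)"
        by (simp add: dfun_hist_shock power_mult_distrib)
      also have "\<dots> = ennreal (\<integral>\<omega>'. ?w * (innov \<alpha> mu Z k ?m \<omega>')\<^sup>2 \<partial>M)"
        using innov_sq_integrable by (intro nn_integral_eq_integral) auto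
      also have "\<dots> = ennreal (?w * (\<integral>\<omega>'. (innov \<alpha> mu Z k ?m \<omega>')\<^sup>2 \<partial>M))"
        by simp
      also have "\<dots> \<le> ennreal (?w * ((1 + v) * (1 + real ?m)))"
        unfolding v_def by (intro ennreal_leI mult_left_mono innov_sq_le) auto
      also have "\<dots> \<le> ennreal (4 * (1 + v) * (U k \<omega> - U (Suc k) \<omega>))"
      proof (rule ennreal_leI)
        have "(1 + v) * (?w * (1 + real ?m)) \<le> (1 + v) * (4 * (U k \<omega> - U (Suc k) \<omega>))"
          unfolding U_def using v by (intro mult_left_mono weight_sq_bound) auto
        then show "?w * ((1 + v) * (1 + real ?m)) \<le> 4 * (1 + v) * (U k \<omega> - U (Suc k) \<omega>)"
          by (simp only: mult_ac)
      qed
      finally show "(\<integral>\<^sup>+\<omega>'. ennreal ((dfun k (hist k \<omega>, shock k \<omega>'))\<^sup>2) \<partial>M)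
          \<le> ennreal (4 * (1 + v) * (U k \<omega> - U (Suc k) \<omega>))" .
    qed
    finally show ?thesis .
  qed
  also have eq: "(\<integral>\<^sup>+\<omega>. ennreal (4 * (1 + v) * (U k \<omega> - U (Suc k) \<omega>)) \<partial>M)
      = ennreal (4 * (1 + v) * (expectation (U k) - expectation (U (Suc k))))" for k
    using U_integrable Unn v by (subst nn_integral_eq_integral) auto
  finally have nn': "(\<integral>\<^sup>+\<omega>. ennreal ((d k \<omega>)\<^sup>2) \<partial>M) \<le> ennreal (4 * (1 + v) * (expectation (U k) - expectation (U (Suc k))))" for k .
  show int: "integrable M (\<lambda>\<omega>. (d k \<omega>)\<^sup>2)" for k
    using nn'[of k] by (intro integrableI_nonneg) (auto simp: le_less_trans)
  have "expectation (\<lambda>\<omega>. (d k \<omega>)\<^sup>2) \<le> 4 * (1 + v) * (expectation (U k) - expectation (U (Suc k)))" for k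
  proof -
    have "expectation (U (Suc k)) \<le> expectation (U k)"
      using Unn U_integrable by (intro integral_mono) auto
    then show ?thesis
      using nn'[of k] v by (subst (asm) nn_integral_eq_integral[OF int]) (auto simp: ennreal_le_iff)
  qed
  then show "\<exists>K\<ge>0. \<forall>k. expectation (\<lambda>\<omega>. (d k \<omega>)\<^sup>2) \<le> K * (expectation (U k) - expectation (U (Suc k)))"
    using v by (intro exI[of _ "4 * (1 + v)"]) auto
qed

text \<open>An event of \<open>F k\<close> is a preimage under \<open>hist k\<close>, so its
  indicator is constant while the shock is integrated out, and the innovation has mean zero.\<close>

lemma d_set_integral:
  assumes "A \<in> sets (F k)"
  shows "(\<integral>\<omega>\<in>A. d k \<omega> \<partial>M) = 0"
proof -
  have "hist k \<in> space M \<rightarrow> space (PiM (past k) (\<lambda>_. count_space UNIV))"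
    using measurable_space[OF hist_measurable] by auto
  then obtain B where B [measurable]: "B \<in> sets (PiM (past k) (\<lambda>_. count_space UNIV))" and A: "A = hist k -` B \<inter> space M"
    using assms unfolding F_def by (auto simp: sets_vimage_algebra2)
  define f where "f z = indicat_real B (fst z) * dfun k z" for z
  have f [measurable]: "f \<in> borel_measurable (PiM (past k) (\<lambda>_. count_space UNIV) \<Otimes>\<^sub>M PiM (present k) (\<lambda>_. count_space UNIV))"
    unfolding f_def by measurable
  have "integrable M (d k)"
    using square_integrable_imp_integrable[OF _ d_sq_integrable] by simp
  moreover have "A \<in> sets M"
    using assms F_subalgebra[of k] by (auto simp: subalgebra_def)
  ultimately have "integrable M (\<lambda>\<omega>. indicat_real A \<omega> * d k \<omega>)"
    by (rule integrable_real_mult_indicator[of A M, simplified mult.commute[of _ "indicat_real A _"], rotated])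
  then have int: "integrable M (\<lambda>\<omega>. f (hist k \<omega>, shock k \<omega>))"
    by (rule Bochner_Integration.integrable_cong[OF refl, THEN iffD1, rotated])
       (auto simp: f_def A dfun_hist_shock d_def indicator_def)
  have "(\<integral>\<omega>\<in>A. d k \<omega> \<partial>M) = (\<integral>\<omega>. f (hist k \<omega>, shock k \<omega>) \<partial>M)"
    unfolding set_lebesgue_integral_def
    by (intro Bochner_Integration.integral_cong) (auto simp: f_def A dfun_hist_shock d_def indicator_def)
  also have "\<dots> = (\<integral>\<omega>. \<integral>\<omega>'. f (hist k \<omega>, shock k \<omega>') \<partial>M \<partial>M)"
    by (rule integral_indep_var[OF hist_shock_indep f int])
  also have "\<dots> = 0"
    by (simp add: f_def dfun_hist_shock innov_mean)
  finally show ?thesis .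
qed

text \<open>The variance bounds telescope along \<open>U\<close>, so their sum is at most a constant
  times the initial expected potential.\<close>

lemma AE_d_summable: "AE \<omega> in M. summable (\<lambda>k. d k \<omega>)"
proof -
  interpret martingale_differences M F d
    by standard (auto simp: F_subalgebra F_mono d_F_measurable d_sq_integrable d_set_integral)
  obtain K where K: "K \<ge> 0" "\<And>k. expectation (\<lambda>\<omega>. (d k \<omega>)\<^sup>2) \<le> K * (expectation (U k) - expectation (U (Suc k)))"
    using d_sq_le by auto
  show ?thesis
  proof (rule AE_summable, rule summableI_nonneg_bounded)
    fix n
    have "(\<Sum>k<n. expectation (\<lambda>\<omega>. (d k \<omega>)\<^sup>2)) \<le> (\<Sum>k<n. K * (expectation (U k) - expectation (U (Suc k))))"
      by (intro sum_mono K)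
    also have "\<dots> = K * (expectation (U 0) - expectation (U n))"
      using sum_lessThan_telescope'[of "\<lambda>k. expectation (U k)" n] by (simp flip: sum_distrib_left)
    also have "\<dots> \<le> K * expectation (U 0)"
      using K(1) by (intro mult_left_mono) (auto simp: U_def intro!: integral_nonneg_AE sqsum_ge_1[THEN order.trans[OF zero_le_one]])
    finally show "(\<Sum>k<n. expectation (\<lambda>\<omega>. (d k \<omega>)\<^sup>2)) \<le> K * expectation (U 0)" .
  qed simp
qed

section \<open>Divergence of the normaliser and negligibility of the noise\<close>

lemma AE_eps_infinitely_often: "AE \<omega> in M. \<forall>m. \<exists>k\<ge>m. Z (IEps (Suc k)) \<omega> \<noteq> 0"
proof (subst AE_all_countable, rule allI)
  fix m
  define q where "q = prob {\<omega> \<in> space M. Z (IEps 1) \<omega> = 0}"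
  have q1: "q < 1"
  proof -
    have "q = prob (space M - {\<omega> \<in> space M. Z (IEps 1) \<omega> \<noteq> 0})"
      unfolding q_def by (rule arg_cong[of _ _ prob]) auto
    also have "\<dots> = 1 - prob {\<omega> \<in> space M. Z (IEps 1) \<omega> \<noteq> 0}"
      by (rule prob_compl) measurable
    finally show ?thesis using eps_nz by simp
  qed
  have q: "prob (Z (IEps (Suc k)) -` {0} \<inter> space M) = q" for k
  proof -
    have "prob (Z (IEps j) -` {0} \<inter> space M) = measure (distr M (count_space UNIV) (Z (IEps j))) {0}" for j
      by (simp add: measure_distr)
    then have "prob (Z (IEps (Suc k)) -` {0} \<inter> space M) = prob (Z (IEps 1) -` {0} \<inter> space M)"
      using eps_ident[of "Suc k"] by simp
    also have "\<dots> = q" unfolding q_def by (rule arg_cong[of _ _ prob]) auto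
    finally show ?thesis .
  qed
  define B where "B = {\<omega> \<in> space M. \<forall>k\<ge>m. Z (IEps (Suc k)) \<omega> = 0}"
  have [measurable]: "B \<in> events" unfolding B_def by measurable
  \<comment> \<open>\<open>B\<close> forces \<open>n + 1\<close> independent innovations to vanish,
    each with probability \<open>q < 1\<close>; \<open>n\<close> is arbitrary.\<close>
  have "prob B \<le> q ^ Suc n" for n
  proof -
    define J where "J = (\<lambda>k. IEps (Suc k)) ` {m..m + n}"
    have card: "card J = Suc n"
      unfolding J_def by (subst card_image) (auto simp: inj_on_def)
    have "B \<subseteq> (\<Inter>i\<in>J. Z i -` {0} \<inter> space M)"
      by (auto simp: B_def J_def)
    then have "prob B \<le> prob (\<Inter>i\<in>J. Z i -` {0} \<inter> space M)"
      by (intro finite_measure_mono sets.finite_INT measurable_sets[OF Z_measurable]) (auto simp: J_def)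
    also have "\<dots> = (\<Prod>i\<in>J. prob (Z i -` {0} \<inter> space M))"
      by (rule indep_varsD[OF indep]) (auto simp: J_def)
    also have "\<dots> = (\<Prod>i\<in>J. q)"
      by (rule prod.cong) (auto simp: J_def q)
    finally show ?thesis using card by simp
  qed
  moreover have "(\<lambda>n. q ^ Suc n) \<longlonglongrightarrow> 0"
    using q1 by (intro LIMSEQ_power_zero[THEN LIMSEQ_Suc]) (auto simp: q_def)
  ultimately have "prob B \<le> 0"
    by (intro LIMSEQ_le_const) auto
  then have "prob B = 0" by (simp add: measure_le_0_iff)
  then have "AE \<omega> in M. \<omega> \<notin> B"
    by (subst AE_iff_measurable[of B]) (auto simp: emeasure_eq_measure B_def)
  then show "AE \<omega> in M. \<exists>k\<ge>m. Z (IEps (Suc k)) \<omega> \<noteq> 0"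
    by (rule AE_mp) (auto intro!: AE_I2 simp: B_def)
qed

text \<open>A nonzero innovation makes the population at least 1 at that time, which raises the sum
  of squares by at least 1; this happens infinitely often.\<close>

lemma AE_sqsum_at_top: "AE \<omega> in M. filterlim (\<lambda>n. sqsum Z n \<omega>) at_top sequentially"
  using AE_eps_infinitely_often
proof (rule AE_mp, intro AE_I2 impI)
  fix \<omega> assume io: "\<forall>m. \<exists>k\<ge>m. Z (IEps (Suc k)) \<omega> \<noteq> 0"
  have *: "\<exists>n. sqsum Z n \<omega> \<ge> real N" for N
  proof (induction N)
    case 0
    show ?case using sqsum_ge_1[of Z 0 \<omega>] by (intro exI[of _ 0]) simp
  next
    case (Suc N)
    then obtain n where n: "sqsum Z n \<omega> \<ge> real N" by blast
    obtain k where k: "k \<ge> n" "Z (IEps (Suc k)) \<omega> \<noteq> 0" using io by blast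
    have "inarX Z (Suc k) \<omega> \<ge> 1" using k by simp
    then have "(real (inarX Z (Suc k) \<omega>))\<^sup>2 \<ge> 1"
      by (simp add: one_le_power del: inarX.simps)
    moreover have "sqsum Z n \<omega> \<le> sqsum Z (Suc k) \<omega>"
      using k sqsum_mono[of Z \<omega>] by (auto simp: incseq_def)
    ultimately have "real (Suc N) \<le> sqsum Z (Suc (Suc k)) \<omega>"
      using n sqsum_Suc[of Z "Suc k" \<omega>] by simp
    then show ?case by blast
  qed
  show "filterlim (\<lambda>n. sqsum Z n \<omega>) at_top sequentially"
    unfolding filterlim_at_top eventually_sequentially
  proof
    fix C :: real
    obtain N where "real N \<ge> C" using real_arch_simple by blast
    moreover obtain n where "sqsum Z n \<omega> \<ge> real N" using * by blast
    ultimately have "\<forall>k\<ge>n. C \<le> sqsum Z k \<omega>"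
      using sqsum_mono[of Z \<omega>] by (auto simp: incseq_def intro: order.trans)
    then show "\<exists>n. \<forall>k\<ge>n. C \<le> sqsum Z k \<omega>" by blast
  qed
qed

text \<open>Kronecker's lemma with \<open>sqsum Z (Suc k)\<close> as normaliser: the quotient series
  is exactly the almost surely convergent series of \<open>d k\<close>.\<close>

lemma AE_cross_sum_negligible:
  "AE \<omega> in M. (\<lambda>n. (\<Sum>k<n. real (inarX Z k \<omega>) * (real (inarX Z (Suc k) \<omega>) - \<alpha> * real (inarX Z k \<omega>) - mu))
      / sqsum Z n \<omega>) \<longlonglongrightarrow> 0"
  using AE_d_summable AE_sqsum_at_top
proof eventually_elim
  case (elim \<omega>)
  define x where "x k = real (inarX Z k \<omega>) * (real (inarX Z (Suc k) \<omega>) - \<alpha> * real (inarX Z k \<omega>) - mu)" for k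
  have "(\<lambda>n. (\<Sum>k\<le>n. x k) / sqsum Z (Suc n) \<omega>) \<longlonglongrightarrow> 0"
  proof (rule kronecker_lemma)
    show "incseq (\<lambda>n. sqsum Z (Suc n) \<omega>)"
      using sqsum_mono[of Z \<omega>] by (auto simp: incseq_def)
    show "sqsum Z (Suc n) \<omega> > 0" for n
      using sqsum_ge_1[of Z "Suc n" \<omega>] by simp
    show "filterlim (\<lambda>n. sqsum Z (Suc n) \<omega>) at_top sequentially"
      using elim(2) by (rule filterlim_compose) (rule filterlim_Suc)
    show "summable (\<lambda>k. x k / sqsum Z (Suc k) \<omega>)"
      using elim(1) unfolding d_def innov_inarX by (simp add: weight_def x_def del: inarX.simps)
  qed
  then have "(\<lambda>n. (\<Sum>k<n. x k) / sqsum Z n \<omega>) \<longlonglongrightarrow> 0"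
    by (subst (asm) lessThan_Suc_atMost[symmetric]) (rule LIMSEQ_imp_Suc)
  then show ?case by (simp add: x_def del: inarX.simps)
qed

end

section \<open>Transfer from the clean process to the contaminated observations\<close>

theorem theorem3p5p1:
  fixes M :: "'a measure" and Z :: "inar_idx \<Rightarrow> 'a \<Rightarrow> nat"
    and \<alpha> mu :: real and s th1 th2 :: nat
  assumes "prob_space M"
    and indep: "prob_space.indep_vars M (\<lambda>_. count_space UNIV) Z UNIV"
    and alpha: "0 < \<alpha>" "\<alpha> < 1"
    and eps_ident: "\<And>k. k \<ge> 1 \<Longrightarrow>
          distr M (count_space UNIV) (Z (IEps k)) = distr M (count_space UNIV) (Z (IEps 1))"
    and eps_sq: "integrable M (\<lambda>\<omega>. (real (Z (IEps 1) \<omega>))\<^sup>2)"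
    and eps_nz: "measure M {\<omega> \<in> space M. Z (IEps 1) \<omega> \<noteq> 0} > 0"
    and mu_def: "mu = integral\<^sup>L M (\<lambda>\<omega>. real (Z (IEps 1) \<omega>))"
    and xi_bin: "\<And>k j \<omega>. k \<ge> 1 \<Longrightarrow> j \<ge> 1 \<Longrightarrow> \<omega> \<in> space M \<Longrightarrow> Z (IXi k j) \<omega> \<le> 1"
    and xi_mean: "\<And>k j. k \<ge> 1 \<Longrightarrow> j \<ge> 1 \<Longrightarrow>
          measure M {\<omega> \<in> space M. Z (IXi k j) \<omega> = 1} = \<alpha>"
    and X0_sq: "integrable M (\<lambda>\<omega>. (real (Z IX0 \<omega>))\<^sup>2)"
    and s: "s \<ge> 1" and th: "th1 \<ge> 1" "th2 \<ge> 1"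
  shows "AE \<omega> in M.
     (\<exists>n0. \<forall>n\<ge>n0. \<exists>!p. \<forall>q.
         Q3 s mu n (\<lambda>k. real (inarY Z s th1 th2 k \<omega>)) p
           \<le> Q3 s mu n (\<lambda>k. real (inarY Z s th1 th2 k \<omega>)) q)
   \<and> (\<lambda>n. fst (cls_est s mu n (\<lambda>k. real (inarY Z s th1 th2 k \<omega>)))) \<longlonglongrightarrow> \<alpha>
   \<and> (\<lambda>n. fst (snd (cls_est s mu n (\<lambda>k. real (inarY Z s th1 th2 k \<omega>)))))
       \<longlonglongrightarrow> real (inarY Z s th1 th2 s \<omega>)
           + (- \<alpha> * (1 + \<alpha>\<^sup>2) * real (inarY Z s th1 th2 (s - 1) \<omega>)
              - \<alpha>\<^sup>2 * real (inarY Z s th1 th2 (s + 2) \<omega>)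
              - (1 - \<alpha> ^ 3) * mu) / (1 + \<alpha>\<^sup>2 + \<alpha> ^ 4)
   \<and> (\<lambda>n. snd (snd (cls_est s mu n (\<lambda>k. real (inarY Z s th1 th2 k \<omega>)))))
       \<longlonglongrightarrow> real (inarY Z s th1 th2 (s + 1) \<omega>)
           + (- \<alpha>\<^sup>2 * real (inarY Z s th1 th2 (s - 1) \<omega>)
              - \<alpha> * (1 + \<alpha>\<^sup>2) * real (inarY Z s th1 th2 (s + 2) \<omega>)
              - (1 - \<alpha> ^ 3) * mu) / (1 + \<alpha>\<^sup>2 + \<alpha> ^ 4)"
proof -
  interpret prob_space M by fact
  interpret inar M Z \<alpha> mu
    by standard (fact indep eps_ident eps_sq eps_nz mu_def xi_bin xi_mean)+
  show ?thesis
    using AE_sqsum_at_top AE_cross_sum_negligible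
  proof eventually_elim
    case (elim \<omega>)
    define y where "y k = real (inarY Z s th1 th2 k \<omega>)" for k
    define x where "x k = real (inarX Z k \<omega>)" for k
    define V where "V n = sqsum Z n \<omega>" for n
    define N where "N n = (\<Sum>k<n. x k * (x (Suc k) - \<alpha> * x k - mu))" for n
    define K where "K n = {1..n} - {s, s+1, s+2}" for n
    define D where "D n = (\<Sum>k\<in>K n. (y (k - 1))\<^sup>2)" for n
    define E where "E n = (\<Sum>k\<in>K n. y (k - 1) * (y k - mu))" for n
    \<comment> \<open>Omitting three summands costs only constants in \<open>n\<close>; the
      additional 1 offsets the one in \<open>sqsum\<close>.\<close>
    define cD where "cD = 1 + (\<Sum>k\<in>{s, s+1, s+2}. (x (k - 1))\<^sup>2)"
    define cN where "cN = (\<Sum>k\<in>{s, s+1, s+2}. x (k - 1) * (x k - \<alpha> * x (k - 1) - mu))"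
    have V: "filterlim V at_top sequentially" and NV: "(\<lambda>n. N n / V n) \<longlonglongrightarrow> 0"
      using elim unfolding V_def N_def x_def by simp_all
    have split: "(\<Sum>k\<in>K n. f k) = (\<Sum>k<n. f (Suc k)) - (\<Sum>k\<in>{s, s+1, s+2}. f k)"
      if "n \<ge> s + 2" for n and f :: "nat \<Rightarrow> real"
    proof -
      have "(\<Sum>k\<in>K n. f k) = (\<Sum>k\<in>{1..n}. f k) - (\<Sum>k\<in>{s, s+1, s+2}. f k)"
        unfolding K_def using that s by (intro sum_diff) auto
      also have "(\<Sum>k\<in>{1..n}. f k) = (\<Sum>k<n. f (Suc k))"
        by (rule sum.reindex_bij_witness[of _ Suc "\<lambda>k. k - 1"]) auto
      finally show ?thesis .
    qed
    \<comment> \<open>An outlier at \<open>s\<close> or \<open>s + 1\<close> enters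
      \<open>y k\<close> or \<open>y (k - 1)\<close> only for \<open>k\<close> among the three
      excluded indices.\<close>
    have yx: "y k = x k" "y (k - 1) = x (k - 1)" if "k \<in> K n" for k n
      using that by (auto simp: K_def y_def x_def inarY_def)
    have D: "D n = V n - cD" if "n \<ge> s + 2" for n
    proof -
      have "D n = (\<Sum>k\<in>K n. (x (k - 1))\<^sup>2)"
        unfolding D_def by (intro sum.cong refl) (simp only: yx)
      also have "\<dots> = (\<Sum>k<n. (x k)\<^sup>2) - (\<Sum>k\<in>{s, s+1, s+2}. (x (k - 1))\<^sup>2)"
        by (subst split[OF that]) simp
      finally show ?thesis by (simp add: V_def sqsum_def x_def cD_def)
    qed
    have E: "E n = N n - cN + \<alpha> * D n" if "n \<ge> s + 2" for n
    proof -
      have "E n - \<alpha> * D n = (\<Sum>k\<in>K n. x (k - 1) * (x k - \<alpha> * x (k - 1) - mu))"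
        unfolding E_def D_def sum_distrib_left sum_subtractf[symmetric]
        by (intro sum.cong refl, unfold yx) (simp add: power2_eq_square algebra_simps)
      also have "\<dots> = N n - cN"
        by (subst split[OF that]) (simp add: N_def cN_def)
      finally show ?thesis by simp
    qed
    have D_top: "filterlim D at_top sequentially"
    proof (rule filterlim_cong[THEN iffD1, OF refl refl])
      show "\<forall>\<^sub>F n in sequentially. - cD + V n = D n"
        using eventually_ge_at_top[of "s + 2"] by eventually_elim (simp add: D)
      show "filterlim (\<lambda>n. - cD + V n) at_top sequentially"
        by (rule filterlim_tendsto_add_at_top[OF tendsto_const V])
    qed
    have cV: "(\<lambda>n. c / V n) \<longlonglongrightarrow> 0" for c
      by (rule real_tendsto_divide_at_top[OF tendsto_const V])
    \<comment> \<open>This is \<open>E n / D n\<close> after dividing numerator and denominator by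
      \<open>V n\<close>, which makes both constant corrections vanish in the limit.\<close>
    have "(\<lambda>n. (N n / V n - cN / V n) / (1 - cD / V n) + \<alpha>) \<longlonglongrightarrow> (0 - 0) / (1 - 0) + \<alpha>"
      by (intro tendsto_intros NV cV) simp
    then have "(\<lambda>n. (N n / V n - cN / V n) / (1 - cD / V n) + \<alpha>) \<longlonglongrightarrow> \<alpha>" by simp
    then have ED: "(\<lambda>n. E n / D n) \<longlonglongrightarrow> \<alpha>"
    proof (rule Lim_transform_eventually)
      have "\<forall>\<^sub>F n in sequentially. D n > 0" "\<forall>\<^sub>F n in sequentially. V n > 0"
        using D_top V by (auto simp: filterlim_at_top_dense)
      then show "\<forall>\<^sub>F n in sequentially. (N n / V n - cN / V n) / (1 - cD / V n) + \<alpha> = E n / D n"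
        using eventually_ge_at_top[of "s + 2"]
      proof eventually_elim
        case (elim n)
        have "(N n / V n - cN / V n) / (1 - cD / V n) = (N n - cN) / D n"
        proof -
          have "N n / V n - cN / V n = (N n - cN) / V n" "1 - cD / V n = D n / V n"
            using elim D[of n] by (simp_all add: diff_divide_distrib)
          then show ?thesis using elim by simp
        qed
        then show ?case
          using elim E[of n] by (simp add: add_divide_distrib)
      qed
    qed
    note cls = cls_asymptotics[where s = s and y = y and mu = mu and \<alpha> = \<alpha>, folded K_def D_def E_def, OF D_top ED]
    show ?case
      using cls unfolding y_def[symmetric] eventually_sequentially by (intro conjI) assumption+
  qed
qed

end
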